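(* Let $\lambda,\mu>0$, let $K\ge1$ be an integer and let $s>0$ (the limit, as $N\to\infty$, of the average number $M_N/N$ of cars per station). If $\nu>0$ is large enough, then there exists a unique equilibrium point in $\mathcal{Y}$ of the Fokker--Planck equation (given in the context). It is the probability measure $\pi(\rho)$ on $\Sigma_K$ given by $$\pi_{j,k,l,m}(\rho)=\frac{1}{Z(\rho)}\frac{\eta_1^j}{j!}\frac{\rho_1^k}{k!}\rho_2^l\frac{\eta_2^m}{m!},\qquad Z(\rho)=\sum_{j+k+l+m\le K}\frac{\eta_1^j}{j!}\frac{\rho_1^k}{k!}\rho_2^l\frac{\eta_2^m}{m!},$$ for $(j,k,l,m)\in\Sigma_K$, where $\rho=(\eta_1,\rho_1,\rho_2,\eta_2)=\left(\frac{\mu}{\nu}\rho_1,\rho_1,\rho_2,\frac{\mu}{\nu}\rho_1\right)$ and $(\rho_1,\rho_2)$ is the unique solution in $[0,\lambda/\mu)\times[0,\infty)$ of $$\rho_1=\frac{\lambda}{\mu}\big(1-\pi_{0V}(\rho)\big),\qquad s=\sum_{j+k+l+m\le K}(k+l+m)\,\pi_{j,k,l,m}(\rho),$$ with $\pi_{0V}(\rho)=\sum_{j+k+m\le K}\pi_{j,k,0,m}(\rho)$.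
   Context: The model is a car-sharing network of $N$ stations, each of capacity $K$, with $M_N$ cars, and $s=\lim_{N\to\infty}M_N/N$. $\mathbb{N}=\{0,1,2,\dots\}$; $\Sigma_K=\{(w,x,y,z)\in\mathbb{N}^4:w+x+y+z\le K\}$, $\Sigma_{<K}=\{(w,x,y,z)\in\mathbb{N}^4:w+x+y+z<K\}$; $\mathcal{P}(\Sigma_K)$ is the set of probability measures on $\Sigma_K$, and $$\mathcal{Y}=\Big\{\Lambda\in\mathcal{P}(\Sigma_K):\sum_{(w,x,y,z)\in\Sigma_K}(x+y+z)\Lambda_{(w,x,y,z)}=s\Big\}.$$ Let $e_1,\dots,e_4$ be the canonical basis of $\mathbb{R}^4$, $p_i:\mathbb{N}^4\to\mathbb{N}$ the $i$-th coordinate projection, and for $f:\Sigma_K\to\mathbb{R}$ and $u\in\Sigma_K$ let $\Delta_{i,i+1}(f)(u)=f(u-e_i+e_{i+1})-f(u)$ ($1\le i\le3$), $\Delta_1^+(f)(u)=f(u+e_1)-f(u)$, $\Delta_4^-(f)(u)=f(u-e_4)-f(u)$ (a product of such a difference with a coefficient that vanishes at $u$ is read as $0$). For a measure $\Lambda$, $\Lambda(f)=\int f\,d\Lambda$; $\{y>0\}$ denotes the set of points with positive third coordinate. The Fokker--Planck equation for $(\Lambda(t))$ is: for every $f$ on $\Sigma_K$ and $t\ge0$, $$\Lambda(t)(f)=\Lambda(0)(f)+\lambda\int_0^t\Lambda(u)(\Sigma_K\cap\{y>0\})\,\Lambda(u)(\Delta_1^+(f)\mathbf{1}_{\Sigma_{<K}})\,du+\nu\int_0^t\Lambda(u)(\Delta_{1,2}(f)p_1)\,du+\mu\int_0^t\Lambda(u)(\Delta_{2,3}(f)p_2)\,du$$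 $$\qquad+\lambda\int_0^t\Lambda(u)(\Sigma_{<K})\,\Lambda(u)(\Delta_{3,4}(f)\mathbf{1}_{\{y>0\}})\,du+\nu\int_0^t\Lambda(u)(\Delta_4^-(f)p_4)\,du.$$ An equilibrium point is a probability measure $\Lambda\in\mathcal{Y}$ such that the constant function $\Lambda(t)\equiv\Lambda$ solves this equation. Convention $0^0=1$.
   Formalization: The formal theorem also assumes s<K. Without it the claim is false: for s>K the set Y is empty, and for s=K the equations for (ρ1,ρ2) have no solution, since π(ρ) gives the empty state positive mass and so its mean number of cars is below K. *)

theory Defs
  imports "HOL-Probability.Probability"
begin

type_synonym state = "nat \<times> nat \<times> nat \<times> nat"

definition Sigma_le :: "nat \<Rightarrow> state set" where
  "Sigma_le K = {(w, x, y, z). w + x + y + z \<le> K}"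

definition Sigma_less :: "nat \<Rightarrow> state set" where
  "Sigma_less K = {(w, x, y, z). w + x + y + z < K}"

lemma finite_Sigma_le: "finite (Sigma_le K)"
  by (rule finite_subset[of _ "{..K} \<times> {..K} \<times> {..K} \<times> {..K}"])
     (auto simp: Sigma_le_def)

(* Probability measures on Sigma_le K are encoded as pmfs supported in Sigma_le K. *)
definition prob_on_Sigma :: "nat \<Rightarrow> state pmf set" where
  "prob_on_Sigma K = {\<Lambda>. set_pmf \<Lambda> \<subseteq> Sigma_le K}"

(* x + y + z <= K on Sigma_le K, so Y_space K s is empty for s > K; for s = K it contains only
   measures concentrated on x + y + z = K. The product-form measures below have a mean strictly
   below K, which is why s < K is assumed for the equilibrium result. *)
definition Y_space :: "nat \<Rightarrow> real \<Rightarrow> state pmf set" where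
  "Y_space K s = {\<Lambda> \<in> prob_on_Sigma K.
     (\<Sum>(w, x, y, z)\<in>Sigma_le K. real (x + y + z) * pmf \<Lambda> (w, x, y, z)) = s}"

(* Test functions are total functions on state. In the equation below every difference is
   multiplied by a coefficient that vanishes wherever the target state would leave Sigma_le K
   (or a subtraction on nat would truncate), so only their values on Sigma_le K matter. *)

fun Delta12 :: "(state \<Rightarrow> real) \<Rightarrow> state \<Rightarrow> real" where
  "Delta12 f (w, x, y, z) = f (w - 1, x + 1, y, z) - f (w, x, y, z)"

fun Delta23 :: "(state \<Rightarrow> real) \<Rightarrow> state \<Rightarrow> real" where
  "Delta23 f (w, x, y, z) = f (w, x - 1, y + 1, z) - f (w, x, y, z)"

fun Delta34 :: "(state \<Rightarrow> real) \<Rightarrow> state \<Rightarrow> real" where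
  "Delta34 f (w, x, y, z) = f (w, x, y - 1, z + 1) - f (w, x, y, z)"

fun Delta1_plus :: "(state \<Rightarrow> real) \<Rightarrow> state \<Rightarrow> real" where
  "Delta1_plus f (w, x, y, z) = f (w + 1, x, y, z) - f (w, x, y, z)"

fun Delta4_minus :: "(state \<Rightarrow> real) \<Rightarrow> state \<Rightarrow> real" where
  "Delta4_minus f (w, x, y, z) = f (w, x, y, z - 1) - f (w, x, y, z)"

fun p1 :: "state \<Rightarrow> real" where "p1 (w, x, y, z) = real w"
fun p2 :: "state \<Rightarrow> real" where "p2 (w, x, y, z) = real x"
fun p4 :: "state \<Rightarrow> real" where "p4 (w, x, y, z) = real z"

definition y_pos :: "state set" where
  "y_pos = {(w, x, y, z). y > 0}"

(* The measurability clause ensures that the five (bounded) integrands are integrable on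
   {0..t}, so that no integral takes its default value 0. *)
definition Fokker_Planck ::
    "real \<Rightarrow> real \<Rightarrow> real \<Rightarrow> nat \<Rightarrow> (real \<Rightarrow> state pmf) \<Rightarrow> bool" where
  "Fokker_Planck lam mu nu K L \<longleftrightarrow>
     (\<forall>t\<ge>0. L t \<in> prob_on_Sigma K) \<and>
     (\<forall>v. set_borel_measurable lborel {0..} (\<lambda>t. pmf (L t) v)) \<and>
     (\<forall>(f :: state \<Rightarrow> real) t. t \<ge> 0 \<longrightarrow>
        measure_pmf.expectation (L t) f =
          measure_pmf.expectation (L 0) f
        + lam * (LBINT u:{0..t}. measure_pmf.prob (L u) (Sigma_le K \<inter> y_pos)
              * measure_pmf.expectation (L u)
                  (\<lambda>v. Delta1_plus f v * indicator (Sigma_less K) v))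
        + nu * (LBINT u:{0..t}. measure_pmf.expectation (L u) (\<lambda>v. Delta12 f v * p1 v))
        + mu * (LBINT u:{0..t}. measure_pmf.expectation (L u) (\<lambda>v. Delta23 f v * p2 v))
        + lam * (LBINT u:{0..t}. measure_pmf.prob (L u) (Sigma_less K)
              * measure_pmf.expectation (L u) (\<lambda>v. Delta34 f v * indicator y_pos v))
        + nu * (LBINT u:{0..t}. measure_pmf.expectation (L u) (\<lambda>v. Delta4_minus f v * p4 v)))"

definition equilibrium_point ::
    "real \<Rightarrow> real \<Rightarrow> real \<Rightarrow> nat \<Rightarrow> real \<Rightarrow> state pmf \<Rightarrow> bool" where
  "equilibrium_point lam mu nu K s \<Lambda> \<longleftrightarrow>
     \<Lambda> \<in> Y_space K s \<and> Fokker_Planck lam mu nu K (\<lambda>t. \<Lambda>)"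

(* Parameter vectors are ordered (eta1, rho1, rho2, eta2). *)

fun weight :: "real \<times> real \<times> real \<times> real \<Rightarrow> state \<Rightarrow> real" where
  "weight (eta1, rho1, rho2, eta2) (j, k, l, m) =
     eta1 ^ j / fact j * (rho1 ^ k / fact k) * rho2 ^ l * (eta2 ^ m / fact m)"

definition partition_fun :: "nat \<Rightarrow> real \<times> real \<times> real \<times> real \<Rightarrow> real" where
  "partition_fun K rho = (\<Sum>u\<in>Sigma_le K. weight rho u)"

definition product_dist :: "nat \<Rightarrow> real \<times> real \<times> real \<times> real \<Rightarrow> state \<Rightarrow> real" where
  "product_dist K rho u = weight rho u / partition_fun K rho"

definition pi_0V :: "nat \<Rightarrow> real \<times> real \<times> real \<times> real \<Rightarrow> real" where
  "pi_0V K rho = (\<Sum>(j, k, m)\<in>{(j, k, m). j + k + m \<le> K}. product_dist K rho (j, k, 0, m))"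

lemma finite_pi_0V_index: "finite {(j, k, m). j + k + m \<le> (K::nat)}"
  by (rule finite_subset[of _ "{..K} \<times> {..K} \<times> {..K}"]) auto

definition rho_vec :: "real \<Rightarrow> real \<Rightarrow> real \<times> real \<Rightarrow> real \<times> real \<times> real \<times> real" where
  "rho_vec mu nu r = (mu / nu * fst r, fst r, snd r, mu / nu * fst r)"

definition fixed_point_eqs ::
    "real \<Rightarrow> real \<Rightarrow> real \<Rightarrow> nat \<Rightarrow> real \<Rightarrow> real \<times> real \<Rightarrow> bool" where
  "fixed_point_eqs lam mu nu K s r \<longleftrightarrow>
     fst r = lam / mu * (1 - pi_0V K (rho_vec mu nu r)) \<and>
     s = (\<Sum>(j, k, l, m)\<in>Sigma_le K.
            real (k + l + m) * product_dist K (rho_vec mu nu r) (j, k, l, m))"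

end

theory Submission
  imports Defs
begin

text \<open>
  For an equilibrium with rates \<open>a = \<Lambda>(y > 0)\<close> and \<open>b = \<Lambda>(\<Sigma>\<^sub><\<^sub>K)\<close>, both positive because
  \<open>0 < s < K\<close>, the linear balance equations force \<open>\<Lambda>\<close> to be of product form with
  \<open>\<rho>\<^sub>1 = \<lambda> a / \<mu>\<close> and \<open>\<rho>\<^sub>2 = a / b\<close>: the transitions split into 5-cycles carrying a constant flux,
  and testing with the density with respect to the product form shows that this density is constant.

  With \<open>c = \<mu> / \<nu>\<close>, the normalising constant is the coefficient \<open>Z\<^sub>K\<close> of \<open>X\<^sup>K\<close> in
  \<open>exp ((1 + 2 c) \<rho>\<^sub>1 X) / ((1 - \<rho>\<^sub>2 X) (1 - X))\<close>. Then \<open>1 - \<pi>\<^sub>0\<^sub>V = \<rho>\<^sub>2 Z\<^bsub>K-1\<^esub> / Z\<^sub>K\<close>, and the mean number of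
  cars is \<open>K - (\<Sum>n<K. Z\<^sub>n / Z\<^sub>K) - c \<rho>\<^sub>1 Z\<^bsub>K-1\<^esub> / Z\<^sub>K\<close>. The coefficients are log-concave, so the ratios
  \<open>Z\<^sub>n / Z\<^sub>K\<close> decrease in both parameters. For small \<open>c\<close>, the mean therefore increases in both
  parameters, while \<open>1 - \<pi>\<^sub>0\<^sub>V\<close> decreases in \<open>\<rho>\<^sub>1\<close> and increases in \<open>\<rho>\<^sub>2\<close>; this gives uniqueness of
  \<open>(\<rho>\<^sub>1, \<rho>\<^sub>2)\<close>. For existence, the first equation is solved for \<open>\<rho>\<^sub>1\<close> as a continuous function of
  \<open>\<rho>\<^sub>2\<close>, along which the mean runs from \<open>0\<close> to \<open>K\<close>.
\<close>


unbundle no vec_syntax and fps_syntax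

subsection \<open>Power series with log-concave coefficients\<close>

definition geo :: "real \<Rightarrow> real fps" where
  "geo q = Abs_fps (\<lambda>n. q ^ n)"

definition nonneg_fps :: "real fps \<Rightarrow> bool" where
  "nonneg_fps F \<longleftrightarrow> (\<forall>n. 0 \<le> F $ n)"

text \<open>Ratios \<open>F $ (n + k) / F $ n\<close> decrease in \<open>n\<close>, cleared of
  denominators. Asking this for all shifts \<open>k\<close> excludes patterns such as 1, 0, 0, 1,
  which a condition on neighbouring coefficients alone would admit.\<close>

definition log_concave_fps :: "real fps \<Rightarrow> bool" where
  "log_concave_fps F \<longleftrightarrow> (\<forall>i j k. i \<le> j \<longrightarrow> F $ i * F $ (j + k) \<le> F $ (i + k) * F $ j)"

lemma geo_nth [simp]: "geo q $ n = q ^ n"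
  by (simp add: geo_def)

lemma geo_unfold: "geo q = 1 + fps_const q * fps_X * geo q"
  by (rule fps_ext) (auto simp: mult.assoc fps_X_mult_nth power_eq_if)

lemma mult_geo_Suc: "(F * geo q) $ Suc n = q * (F * geo q) $ n + F $ Suc n"
proof -
  have "F * geo q = F + fps_const q * (fps_X * (F * geo q))"
    by (subst geo_unfold) (simp add: algebra_simps)
  then have "(F * geo q) $ Suc n = (F + fps_const q * (fps_X * (F * geo q))) $ Suc n"
    by presburger
  then show ?thesis by (simp add: fps_X_mult_nth)
qed

lemma nonneg_fps_mult: "nonneg_fps F \<Longrightarrow> nonneg_fps G \<Longrightarrow> nonneg_fps (F * G)"
  by (auto simp: nonneg_fps_def fps_mult_nth intro!: sum_nonneg)

lemma nonneg_fps_geo: "0 \<le> q \<Longrightarrow> nonneg_fps (geo q)"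
  by (simp add: nonneg_fps_def)

lemma nonneg_fps_exp: "0 \<le> r \<Longrightarrow> nonneg_fps (fps_exp r)"
  by (simp add: nonneg_fps_def)

lemma fact_mult_le: "i \<le> j \<Longrightarrow> (fact (i + k) * fact j :: real) \<le> fact i * fact (j + k)"
proof (induction k)
  case (Suc k)
  have "(fact (i + Suc k) * fact j :: real) = real (i + Suc k) * (fact (i + k) * fact j)"
    by (simp add: algebra_simps)
  also have "\<dots> \<le> real (j + Suc k) * (fact i * fact (j + k))"
    using Suc by (intro mult_mono[OF _ Suc.IH]) auto
  finally show ?case by (simp add: algebra_simps)
qed simp

lemma log_concave_exp:
  assumes "0 \<le> r"
  shows "log_concave_fps (fps_exp r)"
  unfolding log_concave_fps_def
proof (intro allI impI)
  fix i j k :: nat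
  assume "i \<le> j"
  have "r ^ (i + j + k) / (fact i * fact (j + k)) \<le> r ^ (i + j + k) / (fact (i + k) * fact j)"
    using fact_mult_le[OF \<open>i \<le> j\<close>, of k] assms by (intro divide_left_mono) auto
  then show "fps_exp r $ i * fps_exp r $ (j + k) \<le> fps_exp r $ (i + k) * fps_exp r $ j"
    by (simp add: power_add mult_ac)
qed

text \<open>By the recurrence \<open>mult_geo_Suc\<close>, induction on \<open>k\<close> reduces the
  claim to a mixed inequality between \<open>F * geo q\<close> and \<open>F\<close>.\<close>

lemma log_concave_mult_geo:
  assumes "log_concave_fps F" "nonneg_fps F" "0 \<le> q"
  shows "log_concave_fps (F * geo q)"
proof -
  let ?C = "F * geo q"
  have F: "0 \<le> F $ n" for n
    using assms(2) by (simp add: nonneg_fps_def)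
  have C: "0 \<le> ?C $ n" for n
    using nonneg_fps_mult[OF assms(2) nonneg_fps_geo[OF assms(3)]] by (simp add: nonneg_fps_def)
  have C_eq: "?C $ n = (\<Sum>u=0..n. q ^ u * F $ (n - u))" for n
    by (simp add: mult.commute[of F] fps_mult_nth)
  \<comment> \<open>Term by term, log-concavity of \<open>F\<close> moves the shift
    \<open>u + t\<close> from the index \<open>j - u\<close> to \<open>i - u\<close>; the sum is
    then extended from \<open>i\<close> to \<open>j\<close>.\<close>
  have mixed: "?C $ i * F $ (j + t) \<le> F $ (i + t) * ?C $ j" if "i \<le> j" for i j t
  proof -
    have "?C $ i * F $ (j + t) = (\<Sum>u=0..i. q ^ u * (F $ (i - u) * F $ (j + t)))"
      by (simp add: C_eq sum_distrib_right) (simp add: mult_ac)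
    also have "\<dots> \<le> (\<Sum>u=0..i. q ^ u * (F $ (i + t) * F $ (j - u)))"
    proof (intro sum_mono mult_left_mono)
      fix u assume u: "u \<in> {0..i}"
      then have "F $ (i - u) * F $ ((j - u) + (u + t)) \<le> F $ ((i - u) + (u + t)) * F $ (j - u)"
        using assms(1) that unfolding log_concave_fps_def by (meson diff_le_mono)
      then show "F $ (i - u) * F $ (j + t) \<le> F $ (i + t) * F $ (j - u)"
        using u that by simp
    qed (use assms(3) in auto)
    also have "\<dots> \<le> (\<Sum>u=0..j. q ^ u * (F $ (i + t) * F $ (j - u)))"
      using that F assms(3) by (intro sum_mono2) auto
    also have "\<dots> = F $ (i + t) * ?C $ j"
      by (simp add: C_eq sum_distrib_left) (simp add: mult_ac)
    finally show ?thesis .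
  qed
  have "?C $ i * ?C $ (j + k) \<le> ?C $ (i + k) * ?C $ j" if "i \<le> j" for i j k
  proof (induction k)
    case (Suc k)
    have "?C $ i * ?C $ (j + Suc k) = q * (?C $ i * ?C $ (j + k)) + ?C $ i * F $ (j + Suc k)"
      by (simp add: mult_geo_Suc algebra_simps)
    also have "\<dots> \<le> q * (?C $ (i + k) * ?C $ j) + F $ (i + Suc k) * ?C $ j"
      using Suc mixed[OF that, of "Suc k"] assms(3) by (intro add_mono mult_left_mono) auto
    also have "\<dots> = ?C $ (i + Suc k) * ?C $ j"
      by (simp add: mult_geo_Suc algebra_simps)
    finally show ?case .
  qed simp
  then show ?thesis by (simp add: log_concave_fps_def)
qed

text \<open>Log-concavity gives \<open>F $ (m - i) / F $ m <= F $ (n - i) / F $ n\<close> for each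
  summand, so a nonnegative factor \<open>G\<close> raises the coefficient at \<open>n\<close> by at
  least the proportion by which it raises the one at \<open>m\<close>.\<close>

lemma log_concave_mult_ratio:
  assumes "log_concave_fps F" "nonneg_fps F" "nonneg_fps G" "m \<le> n"
  shows "(F * G) $ m * F $ n \<le> F $ m * (F * G) $ n"
proof -
  have nn: "0 \<le> F $ i" "0 \<le> G $ i" for i
    using assms by (simp_all add: nonneg_fps_def)
  have FG: "(F * G) $ k = (\<Sum>i=0..k. G $ i * F $ (k - i))" for k
    by (simp add: mult.commute[of F] fps_mult_nth)
  have "(F * G) $ m * F $ n = (\<Sum>i=0..m. G $ i * (F $ (m - i) * F $ n))"
    by (simp add: FG sum_distrib_right) (simp add: mult_ac)
  also have "\<dots> \<le> (\<Sum>i=0..m. G $ i * (F $ m * F $ (n - i)))"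
  proof (intro sum_mono mult_left_mono)
    fix i assume i: "i \<in> {0..m}"
    then have "F $ (m - i) * F $ ((n - i) + i) \<le> F $ ((m - i) + i) * F $ (n - i)"
      using assms(1,4) unfolding log_concave_fps_def by (meson diff_le_mono)
    then show "F $ (m - i) * F $ n \<le> F $ m * F $ (n - i)"
      using i assms(4) by simp
  qed (use nn in auto)
  also have "\<dots> \<le> (\<Sum>i=0..n. G $ i * (F $ m * F $ (n - i)))"
    using assms(4) nn by (intro sum_mono2) auto
  also have "\<dots> = F $ m * (F * G) $ n"
    by (simp add: FG sum_distrib_left) (simp add: mult_ac)
  finally show ?thesis .
qed

subsection \<open>The normalising constant\<close>

definition Z :: "real \<Rightarrow> real \<Rightarrow> nat \<Rightarrow> real" where
  "Z r q n = (fps_exp r * geo q * geo 1) $ n"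

lemma nonneg_fps_exp_geo: "0 \<le> r \<Longrightarrow> 0 \<le> q \<Longrightarrow> nonneg_fps (fps_exp r * geo q)"
  by (intro nonneg_fps_mult nonneg_fps_geo nonneg_fps_exp)

lemma Z_Suc_ge: "0 \<le> r \<Longrightarrow> 0 \<le> q \<Longrightarrow> Z r q n \<le> Z r q (Suc n)"
  using nonneg_fps_exp_geo[of r q] by (simp add: Z_def mult_geo_Suc nonneg_fps_def)

lemma Z_mono_index: "0 \<le> r \<Longrightarrow> 0 \<le> q \<Longrightarrow> m \<le> n \<Longrightarrow> Z r q m \<le> Z r q n"
  by (rule lift_Suc_mono_le[of "Z r q"]) (auto intro: Z_Suc_ge)

lemma Z_0 [simp]: "Z r q 0 = 1"
  by (simp add: Z_def)

lemma Z_ge_1: "0 \<le> r \<Longrightarrow> 0 \<le> q \<Longrightarrow> 1 \<le> Z r q n"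
  using Z_mono_index[of r q 0 n] by simp

lemma Z_pos: "0 \<le> r \<Longrightarrow> 0 \<le> q \<Longrightarrow> 0 < Z r q n"
  using Z_ge_1[of r q n] by simp

text \<open>States with positive third coordinate contribute the first summand, after removal of one
  unit; those with third coordinate 0 contribute the second.\<close>

lemma Z_recurrence: "Z r q (Suc n) = q * Z r q n + Z r 0 (Suc n)"
proof -
  have "geo 0 = 1"
    by (rule fps_ext) (simp add: power_0_left)
  then have "fps_exp r * geo q * geo 1
      = fps_exp r * geo 0 * geo 1 + fps_const q * (fps_X * (fps_exp r * geo q * geo 1))"
    by (subst geo_unfold[of q]) (simp add: algebra_simps)
  then have "(fps_exp r * geo q * geo 1) $ Suc n
      = (fps_exp r * geo 0 * geo 1 + fps_const q * (fps_X * (fps_exp r * geo q * geo 1))) $ Suc n"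
    by presburger
  then show ?thesis by (simp add: Z_def fps_X_mult_nth)
qed

lemma Z_zero_zero [simp]: "Z 0 0 n = 1"
proof -
  have "geo 0 = 1"
    by (rule fps_ext) (simp add: power_0_left)
  then show ?thesis by (simp add: Z_def)
qed

lemma continuous_on_Z [continuous_intros]:
  assumes "continuous_on S f" "continuous_on S g"
  shows "continuous_on S (\<lambda>x. Z (f x) (g x) n)"
  unfolding Z_def fps_mult_nth geo_nth fps_exp_nth
  by (intro continuous_intros assms) auto

text \<open>
  The quotient of the generating functions at two ordered parameter pairs again has nonnegative
  coefficients, because \<open>(1 - q x) / (1 - q' x) = 1 + (q' - q) x / (1 - q' x)\<close>.
\<close>

lemma generating_function_shift:
  assumes "0 \<le> r" "r \<le> r'" "0 \<le> q" "q \<le> q'"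
  obtains G where "fps_exp r' * geo q' * geo 1 = (fps_exp r * geo q * geo 1) * G"
    "nonneg_fps G" "G $ 0 = 1" "G $ 1 = (r' - r) + (q' - q)"
proof
  let ?H = "1 + fps_const (q' - q) * (fps_X * geo q')"
  let ?G = "fps_exp (r' - r) * ?H"
  have "geo q * ?H = geo q + geo q * (fps_const q' * fps_X * geo q') - (fps_const q * fps_X * geo q) * geo q'"
    by (simp add: algebra_simps flip: fps_const_sub)
  also have "fps_const q' * fps_X * geo q' = geo q' - 1"
    using geo_unfold[of q'] by (simp add: algebra_simps)
  also have "fps_const q * fps_X * geo q = geo q - 1"
    using geo_unfold[of q] by (simp add: algebra_simps)
  finally have "geo q * ?H = geo q'"
    by (simp add: algebra_simps)
  moreover have "fps_exp r' = fps_exp r * fps_exp (r' - r)"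
    by (simp flip: fps_exp_add_mult)
  ultimately show "fps_exp r' * geo q' * geo 1 = (fps_exp r * geo q * geo 1) * ?G"
    by (metis (no_types, opaque_lifting) mult.assoc mult.commute mult.left_commute)
  have "nonneg_fps ?H"
    using assms by (auto simp: nonneg_fps_def fps_X_mult_nth)
  then show "nonneg_fps ?G"
    using assms by (intro nonneg_fps_mult nonneg_fps_exp) auto
  show "?G $ 0 = 1" by simp
  show "?G $ 1 = (r' - r) + (q' - q)"
    by (simp add: fps_mult_nth numeral_2_eq_2)
qed

text \<open>The series at the larger parameters is the log-concave series at the smaller ones times
  a nonnegative series, so \<open>log_concave_mult_ratio\<close> applies.\<close>

lemma Z_ratio_antimono:
  assumes "0 \<le> r" "r \<le> r'" "0 \<le> q" "q \<le> q'" "m \<le> n"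
  shows "Z r' q' m / Z r' q' n \<le> Z r q m / Z r q n"
proof -
  obtain G where G: "fps_exp r' * geo q' * geo 1 = (fps_exp r * geo q * geo 1) * G" "nonneg_fps G"
    using generating_function_shift[OF assms(1-4)] by metis
  have "log_concave_fps (fps_exp r * geo q * geo 1)"
    using assms by (intro log_concave_mult_geo log_concave_exp nonneg_fps_exp nonneg_fps_exp_geo) auto
  moreover have "nonneg_fps (fps_exp r * geo q * geo 1)"
    using assms by (intro nonneg_fps_mult[OF nonneg_fps_exp_geo] nonneg_fps_geo) auto
  ultimately have "Z r' q' m * Z r q n \<le> Z r q m * Z r' q' n"
    unfolding Z_def G(1) by (intro log_concave_mult_ratio G(2) assms(5))
  moreover have "0 < Z r' q' n" "0 < Z r q n"
    using assms by (auto intro!: Z_pos)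
  ultimately show ?thesis by (simp add: divide_simps mult.commute)
qed

text \<open>Only the terms of index 0 and 1 in the convolution with \<open>G\<close> are kept. This
  linear growth supplies strict monotonicity and the quantitative bound in
  \<open>mean_mono_x\<close>.\<close>

lemma Z_Suc_increment:
  assumes "0 \<le> r" "r \<le> r'" "0 \<le> q" "q \<le> q'"
  shows "Z r q (Suc n) + ((r' - r) + (q' - q)) \<le> Z r' q' (Suc n)"
proof -
  let ?F = "fps_exp r * geo q * geo 1"
  obtain G where G: "fps_exp r' * geo q' * geo 1 = ?F * G" "nonneg_fps G"
      "G $ 0 = 1" "G $ 1 = (r' - r) + (q' - q)"
    using generating_function_shift[OF assms] by metis
  have "0 \<le> G $ i * Z r q (Suc n - i)" for i
    using G(2) Z_pos[OF assms(1,3)] by (simp add: nonneg_fps_def less_imp_le)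
  then have "(\<Sum>i\<in>{0,1}. G $ i * Z r q (Suc n - i)) \<le> (\<Sum>i=0..Suc n. G $ i * Z r q (Suc n - i))"
    by (intro sum_mono2) auto
  also have "\<dots> = (G * ?F) $ Suc n"
    by (simp add: fps_mult_nth[of G] Z_def)
  also have "\<dots> = Z r' q' (Suc n)"
    unfolding Z_def G(1) by (simp only: mult.commute)
  finally have "Z r q (Suc n) + G $ 1 * Z r q n \<le> Z r' q' (Suc n)"
    using G(3) by simp
  moreover have "G $ 1 * 1 \<le> G $ 1 * Z r q n"
    using assms Z_ge_1[OF assms(1,3)] G(4) by (intro mult_left_mono) auto
  ultimately show ?thesis using G(4) by simp
qed


subsection \<open>Sums over the state space\<close>

lemma Sigma_less_eq: "1 \<le> K \<Longrightarrow> Sigma_less K = Sigma_le (K - 1)"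
  by (auto simp: Sigma_less_def Sigma_le_def)

lemma Sigma_less_subset: "Sigma_less K \<subseteq> Sigma_le K"
  by (auto simp: Sigma_less_def Sigma_le_def)

lemma finite_Sigma_less: "finite (Sigma_less K)"
  by (rule finite_subset[OF Sigma_less_subset finite_Sigma_le])

text \<open>Reindexing by \<open>u = t + e_i\<close> with \<open>t\<close> in
  \<open>Sigma_less K\<close>; moments and transitions are both brought to this index set.\<close>

lemma sum_Sigma_shift:
  fixes g :: "state \<Rightarrow> real"
  shows "(\<And>x y z. g (0, x, y, z) = 0) \<Longrightarrow>
      (\<Sum>u\<in>Sigma_le K. g u) = (\<Sum>(w, x, y, z)\<in>Sigma_less K. g (Suc w, x, y, z))"
    and "(\<And>w y z. g (w, 0, y, z) = 0) \<Longrightarrow>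
      (\<Sum>u\<in>Sigma_le K. g u) = (\<Sum>(w, x, y, z)\<in>Sigma_less K. g (w, Suc x, y, z))"
    and "(\<And>w x z. g (w, x, 0, z) = 0) \<Longrightarrow>
      (\<Sum>u\<in>Sigma_le K. g u) = (\<Sum>(w, x, y, z)\<in>Sigma_less K. g (w, x, Suc y, z))"
    and "(\<And>w x y. g (w, x, y, 0) = 0) \<Longrightarrow>
      (\<Sum>u\<in>Sigma_le K. g u) = (\<Sum>(w, x, y, z)\<in>Sigma_less K. g (w, x, y, Suc z))"
proof -
  assume zero: "\<And>x y z. g (0, x, y, z) = 0"
  have "(\<Sum>u\<in>Sigma_le K. g u) = (\<Sum>u\<in>Sigma_le K \<inter> {(w, x, y, z). 0 < w}. g u)"
    by (rule sum.mono_neutral_right) (auto simp: zero finite_Sigma_le intro!: gr0I)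
  also have "\<dots> = (\<Sum>(w, x, y, z)\<in>Sigma_less K. g (Suc w, x, y, z))"
    by (rule sum.reindex_bij_witness[where i = "\<lambda>(w, x, y, z). (Suc w, x, y, z)" and
          j = "\<lambda>(w, x, y, z). (w - 1, x, y, z)"]) (auto simp: Sigma_le_def Sigma_less_def)
  finally show "(\<Sum>u\<in>Sigma_le K. g u) = (\<Sum>(w, x, y, z)\<in>Sigma_less K. g (Suc w, x, y, z))" .
next
  assume zero: "\<And>w y z. g (w, 0, y, z) = 0"
  have "(\<Sum>u\<in>Sigma_le K. g u) = (\<Sum>u\<in>Sigma_le K \<inter> {(w, x, y, z). 0 < x}. g u)"
    by (rule sum.mono_neutral_right) (auto simp: zero finite_Sigma_le intro!: gr0I)
  also have "\<dots> = (\<Sum>(w, x, y, z)\<in>Sigma_less K. g (w, Suc x, y, z))"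
    by (rule sum.reindex_bij_witness[where i = "\<lambda>(w, x, y, z). (w, Suc x, y, z)" and
          j = "\<lambda>(w, x, y, z). (w, x - 1, y, z)"]) (auto simp: Sigma_le_def Sigma_less_def)
  finally show "(\<Sum>u\<in>Sigma_le K. g u) = (\<Sum>(w, x, y, z)\<in>Sigma_less K. g (w, Suc x, y, z))" .
next
  assume zero: "\<And>w x z. g (w, x, 0, z) = 0"
  have "(\<Sum>u\<in>Sigma_le K. g u) = (\<Sum>u\<in>Sigma_le K \<inter> {(w, x, y, z). 0 < y}. g u)"
    by (rule sum.mono_neutral_right) (auto simp: zero finite_Sigma_le intro!: gr0I)
  also have "\<dots> = (\<Sum>(w, x, y, z)\<in>Sigma_less K. g (w, x, Suc y, z))"
    by (rule sum.reindex_bij_witness[where i = "\<lambda>(w, x, y, z). (w, x, Suc y, z)" and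
          j = "\<lambda>(w, x, y, z). (w, x, y - 1, z)"]) (auto simp: Sigma_le_def Sigma_less_def)
  finally show "(\<Sum>u\<in>Sigma_le K. g u) = (\<Sum>(w, x, y, z)\<in>Sigma_less K. g (w, x, Suc y, z))" .
next
  assume zero: "\<And>w x y. g (w, x, y, 0) = 0"
  have "(\<Sum>u\<in>Sigma_le K. g u) = (\<Sum>u\<in>Sigma_le K \<inter> {(w, x, y, z). 0 < z}. g u)"
    by (rule sum.mono_neutral_right) (auto simp: zero finite_Sigma_le intro!: gr0I)
  also have "\<dots> = (\<Sum>(w, x, y, z)\<in>Sigma_less K. g (w, x, y, Suc z))"
    by (rule sum.reindex_bij_witness[where i = "\<lambda>(w, x, y, z). (w, x, y, Suc z)" and
          j = "\<lambda>(w, x, y, z). (w, x, y, z - 1)"]) (auto simp: Sigma_le_def Sigma_less_def)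
  finally show "(\<Sum>u\<in>Sigma_le K. g u) = (\<Sum>(w, x, y, z)\<in>Sigma_less K. g (w, x, y, Suc z))" .
qed

lemma sum_Sigma_less: "(\<Sum>u\<in>Sigma_le K. indicator (Sigma_less K) u * g u) = (\<Sum>u\<in>Sigma_less K. g u :: real)"
  by (rule sum.mono_neutral_cong_right) (auto simp: finite_Sigma_le Sigma_less_subset subset_eq[symmetric] intro: subsetD[OF Sigma_less_subset])

lemma sum_Sigma_nested:
  "(\<Sum>u\<in>Sigma_le K. g u) =
    (\<Sum>j=0..K. \<Sum>k=0..K-j. \<Sum>l=0..K-j-k. \<Sum>m=0..K-j-k-l. g (j, k, l, m))"
proof -
  have "Sigma_le K = (SIGMA j:{0..K}. SIGMA k:{0..K-j}. SIGMA l:{0..K-j-k}. {0..K-j-k-l})"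
    by (auto simp: Sigma_le_def)
  then show ?thesis by (simp add: sum.Sigma)
qed

lemma sum_weight: "(\<Sum>u\<in>Sigma_le n. weight (e1, r1, r2, e2) u) = Z (e1 + r1 + e2) r2 n"
proof -
  \<comment> \<open>The factors follow the order of the coordinates, so that the iterated Cauchy
    product has the index ranges of \<open>sum_Sigma_nested\<close>; the innermost
    \<open>geo 1\<close> has all coefficients 1.\<close>
  have "Z (e1 + r1 + e2) r2 n = (fps_exp e1 * (fps_exp r1 * (geo r2 * (fps_exp e2 * geo 1)))) $ n"
    by (simp add: Z_def fps_exp_add_mult mult_ac)
  then show ?thesis
    unfolding sum_Sigma_nested fps_mult_nth sum_distrib_left
    by (auto intro!: sum.cong)
qed

lemma weight_shift:
  "real (Suc j) * weight (e1, r1, r2, e2) (Suc j, k, l, m) = e1 * weight (e1, r1, r2, e2) (j, k, l, m)"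
  "real (Suc k) * weight (e1, r1, r2, e2) (j, Suc k, l, m) = r1 * weight (e1, r1, r2, e2) (j, k, l, m)"
  "weight (e1, r1, r2, e2) (j, k, Suc l, m) = r2 * weight (e1, r1, r2, e2) (j, k, l, m)"
  "real (Suc m) * weight (e1, r1, r2, e2) (j, k, l, Suc m) = e2 * weight (e1, r1, r2, e2) (j, k, l, m)"
  by (simp_all add: divide_simps)

lemma weight_pos:
  "0 < e1 \<Longrightarrow> 0 < r1 \<Longrightarrow> 0 < r2 \<Longrightarrow> 0 < e2 \<Longrightarrow> 0 < weight (e1, r1, r2, e2) u"
  by (cases u) simp

lemma weight_nonneg:
  "0 \<le> e1 \<Longrightarrow> 0 \<le> r1 \<Longrightarrow> 0 \<le> r2 \<Longrightarrow> 0 \<le> e2 \<Longrightarrow> 0 \<le> weight (e1, r1, r2, e2) u"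
  by (cases u) simp

lemma sum_weight_y_pos:
  assumes "1 \<le> K"
  shows "(\<Sum>u\<in>Sigma_le K \<inter> y_pos. weight (e1, r1, r2, e2) u) = r2 * Z (e1 + r1 + e2) r2 (K - 1)"
proof -
  let ?W = "weight (e1, r1, r2, e2)"
  have "(\<Sum>u\<in>Sigma_le K \<inter> y_pos. ?W u) = (\<Sum>u\<in>Sigma_le K. if u \<in> y_pos then ?W u else 0)"
    by (simp add: sum.inter_restrict finite_Sigma_le)
  also have "\<dots> = (\<Sum>(w, x, y, z)\<in>Sigma_less K. ?W (w, x, Suc y, z))"
    by (subst sum_Sigma_shift(3)) (auto simp: y_pos_def)
  also have "\<dots> = r2 * (\<Sum>u\<in>Sigma_less K. ?W u)"
    unfolding sum_distrib_left by (intro sum.cong) (auto simp: weight_shift simp del: weight.simps)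
  finally show ?thesis by (simp only: Sigma_less_eq[OF assms] sum_weight)
qed

lemma sum_weight_w:
  assumes "1 \<le> K"
  shows "(\<Sum>(j, k, l, m)\<in>Sigma_le K. real j * weight (e1, r1, r2, e2) (j, k, l, m))
    = e1 * Z (e1 + r1 + e2) r2 (K - 1)"
proof -
  let ?W = "weight (e1, r1, r2, e2)"
  have "(\<Sum>(j, k, l, m)\<in>Sigma_le K. real j * ?W (j, k, l, m))
      = (\<Sum>(j, k, l, m)\<in>Sigma_less K. real (Suc j) * ?W (Suc j, k, l, m))"
    by (subst sum_Sigma_shift(1)) (auto simp del: weight.simps)
  also have "\<dots> = e1 * (\<Sum>u\<in>Sigma_less K. ?W u)"
    unfolding sum_distrib_left by (intro sum.cong) (auto simp: weight_shift simp del: weight.simps of_nat_Suc)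
  finally show ?thesis by (simp only: Sigma_less_eq[OF assms] sum_weight)
qed

text \<open>Layer-cake summation: a state with \<open>j + k + l + m = t \<le> K\<close> lies in \<open>Sigma_le n\<close> for
  exactly \<open>K - t\<close> indices \<open>n < K\<close>.\<close>

lemma sum_weight_total:
  "(\<Sum>(j, k, l, m)\<in>Sigma_le K. real (j + k + l + m) * weight (e1, r1, r2, e2) (j, k, l, m))
    = real K * Z (e1 + r1 + e2) r2 K - (\<Sum>n<K. Z (e1 + r1 + e2) r2 n)"
proof -
  let ?W = "weight (e1, r1, r2, e2)"
  have layer: "real K - real t = (\<Sum>n<K. if t \<le> n then 1 else 0)" if "t \<le> K" for t
  proof -
    have "{n. n < K \<and> t \<le> n} = {t..<K}" by auto
    then show ?thesis using that by (simp add: sum.If_cases Int_def)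
  qed
  have "(\<Sum>n<K. Z (e1 + r1 + e2) r2 n) = (\<Sum>n<K. \<Sum>u\<in>Sigma_le n. ?W u)"
    by (simp only: sum_weight)
  also have "\<dots> = (\<Sum>n<K. \<Sum>u\<in>Sigma_le K. if u \<in> Sigma_le n then ?W u else 0)"
    by (intro sum.cong refl sum.mono_neutral_cong_left finite_Sigma_le) (auto simp: Sigma_le_def)
  also have "\<dots> = (\<Sum>u\<in>Sigma_le K. \<Sum>n<K. if u \<in> Sigma_le n then ?W u else 0)"
    by (rule sum.swap)
  also have "\<dots> = (\<Sum>(j, k, l, m)\<in>Sigma_le K. (real K - real (j + k + l + m)) * ?W (j, k, l, m))"
  proof (intro sum.cong refl, clarify)
    fix j k l m assume "(j, k, l, m) \<in> Sigma_le K"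
    then show "(\<Sum>n<K. if (j, k, l, m) \<in> Sigma_le n then ?W (j, k, l, m) else 0)
        = (real K - real (j + k + l + m)) * ?W (j, k, l, m)"
      by (subst layer) (auto simp: Sigma_le_def sum_distrib_right if_distrib[of "\<lambda>a. a * _"] simp del: weight.simps cong: if_cong)
  qed
  also have "\<dots> = real K * Z (e1 + r1 + e2) r2 K -
      (\<Sum>(j, k, l, m)\<in>Sigma_le K. real (j + k + l + m) * ?W (j, k, l, m))"
    by (simp add: case_prod_unfold left_diff_distrib sum_subtractf sum_distrib_left flip: sum_weight del: weight.simps of_nat_add)
  finally show ?thesis by simp
qed

subsection \<open>The fixed-point equations\<close>

text \<open>For \<open>c = mu / nu\<close>, \<open>x = rho1\<close> and \<open>q = rho2\<close> this
  is \<open>1 - pi_0V\<close>, the product-form probability of \<open>y_pos\<close>;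
  \<open>(1 + 2 * c) * x\<close> is \<open>eta1 + rho1 + eta2\<close>.\<close>

definition busy :: "nat \<Rightarrow> real \<Rightarrow> real \<Rightarrow> real \<Rightarrow> real" where
  "busy K c x q = q * (Z ((1 + 2 * c) * x) q (K - 1) / Z ((1 + 2 * c) * x) q K)"

text \<open>The first two terms give the mean of \<open>j + k + l + m\<close>; the last one
  subtracts the mean of \<open>j\<close>, as \<open>eta1 = c * x\<close>.\<close>

definition mean :: "nat \<Rightarrow> real \<Rightarrow> real \<Rightarrow> real \<Rightarrow> real" where
  "mean K c x q = real K - (\<Sum>n<K. Z ((1 + 2 * c) * x) q n / Z ((1 + 2 * c) * x) q K)
     - c * x * (Z ((1 + 2 * c) * x) q (K - 1) / Z ((1 + 2 * c) * x) q K)"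

lemma partition_rho_vec: "partition_fun K (rho_vec mu nu (x, q)) = Z ((1 + 2 * (mu / nu)) * x) q K"
  unfolding partition_fun_def rho_vec_def by (simp only: fst_conv snd_conv sum_weight) (simp add: algebra_simps)

lemma Z_arg_nonneg: "0 \<le> c \<Longrightarrow> 0 \<le> x \<Longrightarrow> 0 \<le> (1 + 2 * c) * (x::real)"
  by simp

lemma sum_product_dist:
  assumes "0 < mu" "0 < nu" "0 \<le> x" "0 \<le> q"
  shows "(\<Sum>u\<in>Sigma_le K. product_dist K (rho_vec mu nu (x, q)) u) = 1"
proof -
  have "0 < partition_fun K (rho_vec mu nu (x, q))"
    unfolding partition_rho_vec using assms by (intro Z_pos) auto
  then show ?thesis
    unfolding product_dist_def by (simp flip: sum_divide_distrib add: partition_fun_def)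
qed

lemma sum_product_dist_y_pos:
  assumes "1 \<le> K"
  shows "(\<Sum>u\<in>Sigma_le K \<inter> y_pos. product_dist K (rho_vec mu nu (x, q)) u) = busy K (mu / nu) x q"
proof -
  have "(\<Sum>u\<in>Sigma_le K \<inter> y_pos. weight (rho_vec mu nu (x, q)) u) = q * Z ((1 + 2 * (mu / nu)) * x) q (K - 1)"
    unfolding rho_vec_def fst_conv snd_conv sum_weight_y_pos[OF assms] by (simp add: algebra_simps)
  then show ?thesis
    by (simp add: product_dist_def partition_rho_vec busy_def flip: sum_divide_distrib)
qed

lemma pi_0V_eq_sum: "pi_0V K rho = (\<Sum>u\<in>Sigma_le K - y_pos. product_dist K rho u)"
  unfolding pi_0V_def
  by (rule sum.reindex_bij_witness[where i = "\<lambda>(j, k, l, m). (j, k, m)" and j = "\<lambda>(j, k, m). (j, k, 0, m)"])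
     (auto simp: Sigma_le_def y_pos_def)

lemma pi_0V_rho_vec:
  assumes "0 < mu" "0 < nu" "0 \<le> x" "0 \<le> q" "1 \<le> K"
  shows "pi_0V K (rho_vec mu nu (x, q)) = 1 - busy K (mu / nu) x q"
  using sum_product_dist[OF assms(1-4), of K] sum_product_dist_y_pos[OF assms(5), of mu nu x q]
    sum.Int_Diff[OF finite_Sigma_le, of "product_dist K (rho_vec mu nu (x, q))" K y_pos]
  by (simp add: pi_0V_eq_sum)

lemma mean_product_dist:
  assumes "0 < mu" "0 < nu" "0 \<le> x" "0 \<le> q" "1 \<le> K"
  shows "(\<Sum>(j, k, l, m)\<in>Sigma_le K. real (k + l + m) * product_dist K (rho_vec mu nu (x, q)) (j, k, l, m))
    = mean K (mu / nu) x q"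
proof -
  let ?W = "weight (rho_vec mu nu (x, q))" and ?r = "(1 + 2 * (mu / nu)) * x"
  have "(\<Sum>(j, k, l, m)\<in>Sigma_le K. real (k + l + m) * ?W (j, k, l, m))
      = (\<Sum>(j, k, l, m)\<in>Sigma_le K. real (j + k + l + m) * ?W (j, k, l, m))
      - (\<Sum>(j, k, l, m)\<in>Sigma_le K. real j * ?W (j, k, l, m))"
    by (simp add: case_prod_unfold algebra_simps flip: sum_subtractf)
  also have "\<dots> = real K * Z ?r q K - (\<Sum>n<K. Z ?r q n) - mu / nu * x * Z ?r q (K - 1)"
    unfolding rho_vec_def fst_conv snd_conv sum_weight_w[OF assms(5)] sum_weight_total
    by (simp add: algebra_simps)
  finally have W: "(\<Sum>(j, k, l, m)\<in>Sigma_le K. real (k + l + m) * ?W (j, k, l, m))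
      = real K * Z ?r q K - (\<Sum>n<K. Z ?r q n) - mu / nu * x * Z ?r q (K - 1)" .
  have "0 < Z ?r q K" using assms by (intro Z_pos) auto
  have "(\<Sum>(j, k, l, m)\<in>Sigma_le K. real (k + l + m) * product_dist K (rho_vec mu nu (x, q)) (j, k, l, m))
      = (\<Sum>(j, k, l, m)\<in>Sigma_le K. real (k + l + m) * ?W (j, k, l, m)) / Z ?r q K"
    by (simp add: product_dist_def partition_rho_vec case_prod_unfold sum_divide_distrib)
  also have "\<dots> = mean K (mu / nu) x q"
    unfolding W mean_def using \<open>0 < Z ?r q K\<close> by (simp add: diff_divide_distrib sum_divide_distrib)
  finally show ?thesis .
qed

lemma fixed_point_eqs_iff:
  assumes "0 < mu" "0 < nu" "0 \<le> x" "0 \<le> q" "1 \<le> K"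
  shows "fixed_point_eqs lam mu nu K s (x, q) \<longleftrightarrow>
    x = lam / mu * busy K (mu / nu) x q \<and> s = mean K (mu / nu) x q"
  unfolding fixed_point_eqs_def mean_product_dist[OF assms] pi_0V_rho_vec[OF assms] by simp


section \<open>Monotonicity, continuity and bounds of \<open>busy\<close> and
  \<open>mean\<close>\<close>

lemma busy_antimono:
  assumes "0 \<le> c" "0 \<le> x" "x \<le> x'" "0 \<le> q"
  shows "busy K c x' q \<le> busy K c x q"
  unfolding busy_def using assms
  by (intro mult_left_mono Z_ratio_antimono) auto

text \<open>This is \<open>Z_recurrence\<close> divided by the partition function. Now
  \<open>q\<close> occurs only in the denominator, which exposes monotonicity in \<open>q\<close>
  and the bound by 1.\<close>

lemma busy_eq:
  assumes "0 \<le> c" "0 \<le> x" "0 \<le> q" "1 \<le> K"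
  shows "busy K c x q = 1 - Z ((1 + 2 * c) * x) 0 K / Z ((1 + 2 * c) * x) q K"
proof -
  have "0 < Z ((1 + 2 * c) * x) q K" using assms by (intro Z_pos) auto
  then show ?thesis
    using Z_recurrence[of "(1 + 2 * c) * x" q "K - 1"] assms(4)
    by (simp add: busy_def field_simps)
qed

lemma busy_mono:
  assumes "0 \<le> c" "0 \<le> x" "0 \<le> q" "q \<le> q'" "1 \<le> K"
  shows "busy K c x q \<le> busy K c x q'"
proof -
  let ?r = "(1 + 2 * c) * x"
  have "Z ?r q K \<le> Z ?r q' K"
    using Z_Suc_increment[of ?r ?r q q' "K - 1"] assms by auto
  moreover have "0 < Z ?r q K" "0 < Z ?r q' K" "0 < Z ?r 0 K"
    using assms by (auto intro!: Z_pos)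
  ultimately show ?thesis
    using assms by (simp add: busy_eq divide_left_mono)
qed

lemma busy_nonneg: "0 \<le> c \<Longrightarrow> 0 \<le> x \<Longrightarrow> 0 \<le> q \<Longrightarrow> 0 \<le> busy K c x q"
  unfolding busy_def by (intro mult_nonneg_nonneg divide_nonneg_nonneg less_imp_le[OF Z_pos]) auto

lemma busy_less_1:
  assumes "0 \<le> c" "0 \<le> x" "0 \<le> q" "1 \<le> K"
  shows "busy K c x q < 1"
proof -
  have "0 < Z ((1 + 2 * c) * x) q K" "0 < Z ((1 + 2 * c) * x) 0 K"
    using assms by (auto intro!: Z_pos)
  then show ?thesis using assms by (simp add: busy_eq)
qed

lemma continuous_on_busy:
  assumes "continuous_on S f" "continuous_on S g" "0 \<le> c"
    "\<And>t. t \<in> S \<Longrightarrow> 0 \<le> f t" "\<And>t. t \<in> S \<Longrightarrow> 0 \<le> g t"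
  shows "continuous_on S (\<lambda>t. busy K c (f t) (g t))"
  unfolding busy_def
  by (intro continuous_intros assms ballI less_imp_neq[symmetric] Z_pos Z_arg_nonneg)

lemma continuous_on_mean:
  assumes "continuous_on S f" "continuous_on S g" "0 \<le> c"
    "\<And>t. t \<in> S \<Longrightarrow> 0 \<le> f t" "\<And>t. t \<in> S \<Longrightarrow> 0 \<le> g t"
  shows "continuous_on S (\<lambda>t. mean K c (f t) (g t))"
  unfolding mean_def
  by (intro continuous_intros assms ballI less_imp_neq[symmetric] Z_pos Z_arg_nonneg)

text \<open>Every ratio in \<open>mean\<close> is at most the one with index \<open>K - 1\<close>,
  and that one is at most \<open>1 / q\<close> because \<open>busy\<close> is below 1. Hence the
  mean approaches \<open>K\<close> for large \<open>q\<close>, uniformly over bounded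
  \<open>x\<close>.\<close>

lemma mean_ge:
  assumes "0 \<le> c" "0 \<le> x" "0 < q" "1 \<le> K"
  shows "real K - (real K + c * x) / q \<le> mean K c x q"
proof -
  let ?Z = "Z ((1 + 2 * c) * x) q" and ?\<phi> = "Z ((1 + 2 * c) * x) q (K - 1) / Z ((1 + 2 * c) * x) q K"
  have pos: "0 < ?Z n" for n using assms by (intro Z_pos) auto
  have "(\<Sum>n<K. ?Z n / ?Z K) \<le> (\<Sum>n<K. ?\<phi>)"
    using assms by (intro sum_mono divide_right_mono Z_mono_index less_imp_le[OF pos]) auto
  moreover have "(\<Sum>n<K. ?\<phi>) = real K * ?\<phi>"
    by simp
  moreover have "(real K + c * x) * ?\<phi> = real K * ?\<phi> + c * x * ?\<phi>"
    by (rule distrib_right)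
  ultimately have "real K - (real K + c * x) * ?\<phi> \<le> mean K c x q"
    unfolding mean_def by linarith
  moreover have "q * ?\<phi> \<le> 1"
    using busy_less_1[of c x q K] assms by (simp add: busy_def)
  then have "?\<phi> \<le> 1 / q"
    using assms by (simp add: field_simps)
  then have "(real K + c * x) * ?\<phi> \<le> (real K + c * x) * (1 / q)"
    using assms by (intro mult_left_mono) auto
  ultimately show ?thesis by simp
qed

lemma mean_eq_0: "1 \<le> K \<Longrightarrow> mean K c 0 0 = 0"
  by (simp add: mean_def)

text \<open>The term \<open>n = 0\<close> in the sum defining the mean yields strict monotonicity; in the
  direction of \<open>x\<close>, it has to absorb the growth of \<open>c * x\<close>.\<close>

lemma mean_sum_diff:
  assumes "0 \<le> r" "r \<le> r'" "0 \<le> q" "q \<le> q'" "1 \<le> K"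
  shows "(\<Sum>n<K. Z r' q' n / Z r' q' K) + (1 / Z r q K - 1 / Z r' q' K) \<le> (\<Sum>n<K. Z r q n / Z r q K)"
proof -
  obtain K' where K: "K = Suc K'" using assms(5) by (cases K) auto
  have "(\<Sum>n<K'. Z r' q' (Suc n) / Z r' q' K) \<le> (\<Sum>n<K'. Z r q (Suc n) / Z r q K)"
    using assms by (intro sum_mono Z_ratio_antimono) (auto simp: K)
  then show ?thesis
    by (simp add: K sum.lessThan_Suc_shift del: sum.lessThan_Suc)
qed

lemma mean_strict_mono_q:
  assumes "0 \<le> c" "0 \<le> x" "0 \<le> q" "q < q'" "1 \<le> K"
  shows "mean K c x q < mean K c x q'"
proof -
  let ?r = "(1 + 2 * c) * x"
  have r: "0 \<le> ?r" using assms by simp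
  have "c * x * (Z ?r q' (K - 1) / Z ?r q' K) \<le> c * x * (Z ?r q (K - 1) / Z ?r q K)"
    using assms r by (intro mult_left_mono Z_ratio_antimono) auto
  moreover have "Z ?r q K < Z ?r q' K"
    using Z_Suc_increment[of ?r ?r q q' "K - 1"] assms r by auto
  then have "0 < 1 / Z ?r q K - 1 / Z ?r q' K"
    using Z_pos[OF r assms(3), of K] by (simp add: frac_less2)
  ultimately show ?thesis
    using mean_sum_diff[of ?r ?r q q' K] assms r unfolding mean_def by simp
qed

text \<open>The term subtracted in \<open>mean\<close> grows by at most \<open>c * (x' - x)\<close>,
  while the sum of ratios falls by at least \<open>(x' - x) / Z^2\<close>, with \<open>Z\<close>
  taken at \<open>x'\<close>. The assumption \<open>small\<close> makes the gain outweigh the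
  loss.\<close>

lemma mean_mono_x:
  assumes "0 \<le> c" "0 \<le> x" "x \<le> x'" "0 \<le> q" "1 \<le> K"
    and small: "c * (Z ((1 + 2 * c) * x') q K)\<^sup>2 \<le> 1"
  shows "mean K c x q \<le> mean K c x' q"
proof -
  let ?r = "(1 + 2 * c) * x" and ?r' = "(1 + 2 * c) * x'"
  let ?\<phi> = "\<lambda>r. Z r q (K - 1) / Z r q K"
  have r: "0 \<le> ?r" "?r \<le> ?r'" using assms by (auto intro: mult_left_mono)
  have pos: "0 < Z ?r q K" "0 < Z ?r' q K" using assms by (auto intro!: Z_pos)
  have incr: "Z ?r q K + (?r' - ?r) \<le> Z ?r' q K"
    using Z_Suc_increment[of ?r ?r' q q "K - 1"] assms r by auto
  have "c * x' * ?\<phi> ?r' \<le> c * x' * ?\<phi> ?r"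
    using assms r by (intro mult_left_mono Z_ratio_antimono) auto
  moreover have "?\<phi> ?r \<le> 1"
    using Z_mono_index[of ?r q "K - 1" K] r assms pos by simp
  then have "c * (x' - x) * ?\<phi> ?r \<le> c * (x' - x) * 1"
    using assms by (intro mult_left_mono) auto
  moreover have "c * (x' - x) * ?\<phi> ?r = c * x' * ?\<phi> ?r - c * x * ?\<phi> ?r"
    by (simp only: right_diff_distrib left_diff_distrib)
  ultimately have upper: "c * x' * ?\<phi> ?r' - c * x * ?\<phi> ?r \<le> c * (x' - x)"
    by linarith
  have "x' - x \<le> ?r' - ?r"
    using mult_left_mono[OF assms(3), of "2 * c"] assms(1) by (simp add: algebra_simps)
  have le: "Z ?r q K \<le> Z ?r' q K"
    using incr r(2) by linarith
  have "c * (x' - x) \<le> (x' - x) / (Z ?r' q K)\<^sup>2"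
    using mult_right_mono[OF small, of "x' - x"] assms pos by (simp add: field_simps)
  also have "\<dots> \<le> (x' - x) / (Z ?r q K * Z ?r' q K)"
    using le pos assms unfolding power2_eq_square
    by (intro divide_left_mono mult_right_mono mult_pos_pos) auto
  also have "\<dots> \<le> (Z ?r' q K - Z ?r q K) / (Z ?r q K * Z ?r' q K)"
    using incr \<open>x' - x \<le> ?r' - ?r\<close> pos by (intro divide_right_mono) auto
  also have "\<dots> = 1 / Z ?r q K - 1 / Z ?r' q K"
    using pos by (simp add: divide_simps)
  finally show ?thesis
    using mean_sum_diff[of ?r ?r' q q K] assms r upper unfolding mean_def by simp
qed

section \<open>Existence and uniqueness of the pair \<open>(x, q)\<close>\<close>

lemma ex_busy_solution:
  assumes "0 < a" "0 \<le> c" "0 \<le> q" "1 \<le> K"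
  shows "\<exists>x. 0 \<le> x \<and> x < a \<and> x = a * busy K c x q"
proof -
  have "continuous_on {0..a} (\<lambda>x. x - a * busy K c x q)"
    using assms by (intro continuous_intros continuous_on_busy) auto
  moreover have "0 - a * busy K c 0 q \<le> 0" "0 \<le> a - a * busy K c a q"
    using assms busy_nonneg[of c 0 q K] busy_less_1[of c a q K] by auto
  ultimately obtain x where x: "0 \<le> x" "x \<le> a" "x - a * busy K c x q = 0"
    using IVT'[of "\<lambda>x. x - a * busy K c x q" 0 0 a] assms(1) by auto
  moreover have "a * busy K c x q < a * 1"
    using assms busy_less_1[of c x q K] x by (intro mult_strict_left_mono) auto
  ultimately show ?thesis by (intro exI[of _ x]) auto
qed

text \<open>Since \<open>busy\<close> decreases in \<open>x\<close>, solutions at different \<open>q\<close> are at most as far apart as the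
  right-hand sides at one common \<open>x\<close>.\<close>

lemma busy_solution_dist:
  assumes "0 < a" "0 \<le> c" "0 \<le> q" "0 \<le> x" "x = a * busy K c x q"
    "0 \<le> y" "y = a * busy K c y p" "0 \<le> p"
  shows "\<bar>x - y\<bar> \<le> a * \<bar>busy K c y q - busy K c y p\<bar>"
proof (cases "y \<le> x")
  case True
  have "a * busy K c x q \<le> a * busy K c y q"
    using assms True by (intro mult_left_mono busy_antimono) auto
  then have "x - y \<le> a * (busy K c y q - busy K c y p)"
    using assms(5,7) by (simp add: right_diff_distrib)
  also have "\<dots> \<le> a * \<bar>busy K c y q - busy K c y p\<bar>"
    using assms(1) by (intro mult_left_mono) auto
  finally show ?thesis using True by simp
next
  case False
  have "a * busy K c y q \<le> a * busy K c x q"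
    using assms False by (intro mult_left_mono busy_antimono) auto
  then have "y - x \<le> a * (busy K c y p - busy K c y q)"
    using assms(5,7) by (simp add: right_diff_distrib)
  also have "\<dots> \<le> a * \<bar>busy K c y q - busy K c y p\<bar>"
    using assms(1) by (intro mult_left_mono) auto
  finally show ?thesis using False by simp
qed

lemma ex_fixed_point:
  assumes "0 < a" "0 \<le> c" "1 \<le> K" "0 < s" "s < real K"
  shows "\<exists>x q. 0 \<le> x \<and> x < a \<and> 0 \<le> q \<and> x = a * busy K c x q \<and> s = mean K c x q"
proof -
  obtain X where X: "\<And>q. 0 \<le> q \<Longrightarrow> 0 \<le> X q \<and> X q < a \<and> X q = a * busy K c (X q) q"
    using ex_busy_solution[OF assms(1,2) _ assms(3)] by metis
  have cont: "continuous_on {0..} X"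
    unfolding continuous_on_def
  proof
    fix p :: real assume p: "p \<in> {0..}"
    have "continuous_on {0..} (\<lambda>q. busy K c (X p) q)"
      using assms(2) X[of p] p by (intro continuous_on_busy continuous_intros) auto
    then have "((\<lambda>q. busy K c (X p) q) \<longlongrightarrow> busy K c (X p) p) (at p within {0..})"
      using p by (auto simp: continuous_on_def)
    then have lim: "((\<lambda>q. a * \<bar>busy K c (X p) q - busy K c (X p) p\<bar>) \<longlongrightarrow> 0) (at p within {0..})"
      by (auto intro!: tendsto_eq_intros)
    have bound: "norm (X q - X p) \<le> a * \<bar>busy K c (X p) q - busy K c (X p) p\<bar>" if "q \<in> {0..}" for q
      using busy_solution_dist[OF assms(1,2), of q "X q" K "X p" p] X[of q] X[of p] p that by auto
    have "((\<lambda>q. X q - X p) \<longlongrightarrow> 0) (at p within {0..})"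
      by (rule Lim_null_comparison[OF _ lim]) (use bound in \<open>auto simp: eventually_at_filter\<close>)
    then show "(X \<longlongrightarrow> X p) (at p within {0..})"
      by (simp add: LIM_zero_iff)
  qed
  \<comment> \<open>With \<open>x\<close> replaced by its bound \<open>a\<close>, the lower bound of
    \<open>mean_ge\<close> at \<open>Q\<close> equals \<open>s\<close>.\<close>
  define Q where "Q = (real K + c * a) / (real K - s)"
  have "0 < real K + c * a" using assms by (intro add_pos_nonneg) auto
  then have Q: "0 < Q" "(real K + c * a) / Q = real K - s" using assms by (auto simp: Q_def)
  have "continuous_on {0..Q} (\<lambda>q. mean K c (X q) q)"
    using X assms(2) by (intro continuous_on_mean continuous_intros continuous_on_subset[OF cont]) auto
  moreover have "X 0 = 0" using X[of 0] by (simp add: busy_def)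
  then have "mean K c (X 0) 0 \<le> s" using assms mean_eq_0 by simp
  moreover have "s \<le> mean K c (X Q) Q"
  proof -
    have "(real K + c * X Q) / Q \<le> (real K + c * a) / Q"
      using X[of Q] Q(1) assms(2) by (intro divide_right_mono add_left_mono mult_left_mono) auto
    then show ?thesis using mean_ge[of c "X Q" Q K] X[of Q] Q assms by auto
  qed
  ultimately obtain q where "0 \<le> q" "mean K c (X q) q = s"
    using IVT'[of "\<lambda>q. mean K c (X q) q" 0 s Q] Q(1) by auto
  then show ?thesis using X by blast
qed

text \<open>This is \<open>mean_ge\<close> solved for \<open>q\<close>. The bound is free of
  \<open>c\<close>, so \<open>nu0\<close> can be chosen before \<open>nu\<close>.\<close>

lemma fixed_point_q_le:
  assumes "0 \<le> c" "1 \<le> K" "s < real K" "0 \<le> x" "0 \<le> q" "s = mean K c x q" "c * x \<le> 1"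
  shows "q \<le> (real K + 1) / (real K - s)"
proof (cases "q = 0")
  case False
  have "real K - (real K + c * x) / q \<le> s"
    using mean_ge[of c x q K] assms False by simp
  then have "q * (real K - s) \<le> real K + c * x"
    using assms False by (simp add: field_simps)
  then have "q * (real K - s) \<le> real K + 1" using assms(7) by simp
  then show ?thesis using assms(3) by (simp add: pos_le_divide_eq)
qed (use assms in auto)

text \<open>If \<open>p <= q\<close>, monotonicity of \<open>busy\<close> forces
  \<open>y <= x\<close>, hence \<open>x = y\<close>, and the strictly increasing mean gives
  \<open>q = p\<close>. If \<open>q < p\<close>, the mean would be strictly larger at
  \<open>(y, p)\<close> than at \<open>(x, q)\<close>.\<close>

lemma fixed_point_unique_aux:
  assumes c: "0 \<le> c" "c \<le> 1" "c * a \<le> 1" and "0 < a" "1 \<le> K" "s < real K"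
    and small: "c * (Z (3 * a) ((real K + 1) / (real K - s)) K)\<^sup>2 \<le> 1"
    and x: "0 \<le> x" "x \<le> a" "0 \<le> q" "x = a * busy K c x q" "s = mean K c x q"
    and y: "0 \<le> y" "y \<le> a" "0 \<le> p" "y = a * busy K c y p" "s = mean K c y p"
    and le: "x \<le> y"
  shows "x = y \<and> q = p"
proof (cases "p \<le> q")
  case True
  have "busy K c y p \<le> busy K c x q"
    using busy_antimono[of c x y p K] busy_mono[of c x p q K] assms True by linarith
  then have "y \<le> x"
    using \<open>0 < a\<close> x(4) y(4) by (metis mult_le_cancel_left_pos)
  with le have "x = y" by simp
  moreover have "q = p"
    using mean_strict_mono_q[of c x p q K] assms True \<open>x = y\<close> by (cases "p < q") auto
  ultimately show ?thesis by simp
next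
  case False
  let ?Q = "(real K + 1) / (real K - s)"
  have "c * x \<le> c * a" using x c by (intro mult_left_mono) auto
  then have q: "q \<le> ?Q"
    using fixed_point_q_le[of c K s x q] assms by auto
  \<comment> \<open>Bounding the parameter by \<open>3 * a\<close> through \<open>c <= 1\<close>
    makes \<open>small\<close> applicable.\<close>
  have "(1 + 2 * c) * y \<le> 3 * a"
    using c x y by (intro mult_mono) auto
  then have "Z ((1 + 2 * c) * y) q K \<le> Z (3 * a) ?Q K"
    using Z_Suc_increment[of "(1 + 2 * c) * y" "3 * a" q ?Q "K - 1"] q assms by auto
  moreover have "0 < Z ((1 + 2 * c) * y) q K" using assms by (intro Z_pos) auto
  ultimately have "c * (Z ((1 + 2 * c) * y) q K)\<^sup>2 \<le> c * (Z (3 * a) ?Q K)\<^sup>2"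
    using c by (intro mult_left_mono power_mono) auto
  then have "mean K c x q \<le> mean K c y q"
    using assms by (intro mean_mono_x) auto
  also have "\<dots> < mean K c y p"
    using assms False by (intro mean_strict_mono_q) auto
  finally show ?thesis using x(5) y(5) by simp
qed

lemma fixed_point_unique:
  assumes "0 < lam" "0 < mu" "1 \<le> K" "0 < s" "s < real K"
  shows "\<exists>nu0>0. \<forall>nu\<ge>nu0. \<exists>!r. r \<in> {0..<lam / mu} \<times> {0..} \<and> fixed_point_eqs lam mu nu K s r"
proof -
  let ?a = "lam / mu"
  define B where "B = (Z (3 * ?a) ((real K + 1) / (real K - s)) K)\<^sup>2"
  \<comment> \<open>The three summands ensure, in this order, \<open>c <= 1\<close>,
    \<open>c * (lam / mu) <= 1\<close> and \<open>c * B <= 1\<close> for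
    \<open>c = mu / nu\<close>.\<close>
  define nu0 where "nu0 = mu + lam + mu * B"
  have a: "0 < ?a" using assms by simp
  have "0 \<le> B" by (simp add: B_def)
  have "0 < nu0" using assms \<open>0 \<le> B\<close> by (simp add: nu0_def add_pos_nonneg)
  moreover have "\<exists>!r. r \<in> {0..<?a} \<times> {0..} \<and> fixed_point_eqs lam mu nu K s r" if "nu0 \<le> nu" for nu
  proof -
    have nu: "0 < nu" using \<open>0 < nu0\<close> that by simp
    let ?c = "mu / nu"
    have "0 \<le> mu * B" using assms \<open>0 \<le> B\<close> by simp
    then have c: "0 \<le> ?c" "?c \<le> 1" "?c * ?a \<le> 1" "?c * B \<le> 1"
      using assms nu that by (auto simp: nu0_def divide_simps)
    note iff = fixed_point_eqs_iff[OF assms(2) nu _ _ assms(3), of _ _ lam s]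
    obtain x q where "0 \<le> x" "x < ?a" "0 \<le> q" "x = ?a * busy K ?c x q" "s = mean K ?c x q"
      using ex_fixed_point[OF a c(1) assms(3-5)] by blast
    then have "(x, q) \<in> {0..<?a} \<times> {0..} \<and> fixed_point_eqs lam mu nu K s (x, q)"
      using iff by simp
    moreover have "r = r'"
      if r: "r \<in> {0..<?a} \<times> {0..} \<and> fixed_point_eqs lam mu nu K s r"
        and r': "r' \<in> {0..<?a} \<times> {0..} \<and> fixed_point_eqs lam mu nu K s r'" for r r'
    proof -
      obtain x q y p where eq: "r = (x, q)" "r' = (y, p)" by (cases r, cases r') auto
      have x: "0 \<le> x" "x \<le> ?a" "0 \<le> q" "x = ?a * busy K ?c x q" "s = mean K ?c x q"
        using r iff[of x q] by (auto simp: eq)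
      have y: "0 \<le> y" "y \<le> ?a" "0 \<le> p" "y = ?a * busy K ?c y p" "s = mean K ?c y p"
        using r' iff[of y p] by (auto simp: eq)
      note unique = fixed_point_unique_aux[OF c(1-3) a assms(3,5) c(4)[unfolded B_def]]
      show ?thesis
        using unique[OF x y] unique[OF y x] by (cases "x \<le> y") (auto simp: eq)
    qed
    ultimately show ?thesis by blast
  qed
  ultimately show ?thesis by blast
qed


subsection \<open>Balance equations\<close>

text \<open>The sum of the five integrands for a constant path. The two rates are frozen as
  parameters \<open>a\<close> and \<open>b\<close>, so that the expression is linear in
  \<open>P\<close> and in \<open>f\<close>.\<close>

definition drift :: "real \<Rightarrow> real \<Rightarrow> real \<Rightarrow> nat \<Rightarrow> real \<Rightarrow> real \<Rightarrow> (state \<Rightarrow> real) \<Rightarrow> (state \<Rightarrow> real) \<Rightarrow> real" where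
  "drift lam mu nu K a b P f =
     lam * (a * (\<Sum>v\<in>Sigma_le K. Delta1_plus f v * indicator (Sigma_less K) v * P v))
   + nu * (\<Sum>v\<in>Sigma_le K. Delta12 f v * p1 v * P v)
   + mu * (\<Sum>v\<in>Sigma_le K. Delta23 f v * p2 v * P v)
   + lam * (b * (\<Sum>v\<in>Sigma_le K. Delta34 f v * indicator y_pos v * P v))
   + nu * (\<Sum>v\<in>Sigma_le K. Delta4_minus f v * p4 v * P v)"

lemma LBINT_const: "0 \<le> t \<Longrightarrow> (LBINT u:{0..t}. c) = t * (c::real)"
  by (simp add: set_lebesgue_integral_def)

text \<open>Constant integrands turn the equation into \<open>t\<close> times the drift being 0, and
  one positive \<open>t\<close> suffices.\<close>

lemma Fokker_Planck_const_iff: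
  assumes "\<Lambda> \<in> prob_on_Sigma K"
  shows "Fokker_Planck lam mu nu K (\<lambda>t. \<Lambda>) \<longleftrightarrow>
    (\<forall>f. drift lam mu nu K (measure_pmf.prob \<Lambda> (Sigma_le K \<inter> y_pos))
      (measure_pmf.prob \<Lambda> (Sigma_less K)) (pmf \<Lambda>) f = 0)"
proof -
  have E: "measure_pmf.expectation \<Lambda> f = (\<Sum>v\<in>Sigma_le K. f v * pmf \<Lambda> v)" for f
    using assms by (intro integral_measure_pmf_real finite_Sigma_le) (auto simp: prob_on_Sigma_def)
  have meas: "set_borel_measurable lborel {0..} (\<lambda>t::real. pmf \<Lambda> v)" for v
    unfolding set_borel_measurable_def by measurable
  let ?D = "drift lam mu nu K (measure_pmf.prob \<Lambda> (Sigma_le K \<inter> y_pos))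
      (measure_pmf.prob \<Lambda> (Sigma_less K)) (pmf \<Lambda>)"
  have "Fokker_Planck lam mu nu K (\<lambda>t. \<Lambda>) \<longleftrightarrow> (\<forall>f t. 0 \<le> t \<longrightarrow>
      measure_pmf.expectation \<Lambda> f = measure_pmf.expectation \<Lambda> f + t * ?D f)"
    unfolding Fokker_Planck_def using assms meas
    by (simp add: LBINT_const drift_def E algebra_simps cong: conj_cong)
  also have "\<dots> \<longleftrightarrow> (\<forall>f. ?D f = 0)"
    by simp (metis zero_le_one zero_neq_one)
  finally show ?thesis .
qed

text \<open>The transitions are arranged in 5-cycles \<open>t, t + e1, t + e2, t + e3, t + e4, t\<close>, one for
  every \<open>t\<close> in \<open>Sigma_less K\<close>.\<close>

lemma drift_cycles:
  "drift lam mu nu K a b P f = (\<Sum>(w, x, y, z)\<in>Sigma_less K.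
      lam * a * P (w, x, y, z) * (f (Suc w, x, y, z) - f (w, x, y, z))
    + nu * (real (Suc w) * P (Suc w, x, y, z)) * (f (w, Suc x, y, z) - f (Suc w, x, y, z))
    + mu * (real (Suc x) * P (w, Suc x, y, z)) * (f (w, x, Suc y, z) - f (w, Suc x, y, z))
    + lam * b * P (w, x, Suc y, z) * (f (w, x, y, Suc z) - f (w, x, Suc y, z))
    + nu * (real (Suc z) * P (w, x, y, Suc z)) * (f (w, x, y, z) - f (w, x, y, Suc z)))"
proof -
  have 1: "(\<Sum>v\<in>Sigma_le K. Delta1_plus f v * indicator (Sigma_less K) v * P v)
      = (\<Sum>(w, x, y, z)\<in>Sigma_less K. P (w, x, y, z) * (f (Suc w, x, y, z) - f (w, x, y, z)))"
    by (subst sum_Sigma_less[symmetric]) (auto intro!: sum.cong)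
  have 2: "(\<Sum>v\<in>Sigma_le K. Delta12 f v * p1 v * P v)
      = (\<Sum>(w, x, y, z)\<in>Sigma_less K. real (Suc w) * P (Suc w, x, y, z) * (f (w, Suc x, y, z) - f (Suc w, x, y, z)))"
    by (subst sum_Sigma_shift(1)) (auto intro!: sum.cong)
  have 3: "(\<Sum>v\<in>Sigma_le K. Delta23 f v * p2 v * P v)
      = (\<Sum>(w, x, y, z)\<in>Sigma_less K. real (Suc x) * P (w, Suc x, y, z) * (f (w, x, Suc y, z) - f (w, Suc x, y, z)))"
    by (subst sum_Sigma_shift(2)) (auto intro!: sum.cong)
  have 4: "(\<Sum>v\<in>Sigma_le K. Delta34 f v * indicator y_pos v * P v)
      = (\<Sum>(w, x, y, z)\<in>Sigma_less K. P (w, x, Suc y, z) * (f (w, x, y, Suc z) - f (w, x, Suc y, z)))"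
    by (subst sum_Sigma_shift(3)) (auto intro!: sum.cong simp: y_pos_def)
  have 5: "(\<Sum>v\<in>Sigma_le K. Delta4_minus f v * p4 v * P v)
      = (\<Sum>(w, x, y, z)\<in>Sigma_less K. real (Suc z) * P (w, x, y, Suc z) * (f (w, x, y, z) - f (w, x, y, Suc z)))"
    by (subst sum_Sigma_shift(4)) (auto intro!: sum.cong)
  show ?thesis
    unfolding drift_def 1 2 3 4 5 sum_distrib_left sum.distrib[symmetric]
    by (intro sum.cong refl) (auto simp del: of_nat_Suc)
qed

text \<open>The two relations for \<open>x\<close> and \<open>q\<close> and the one-step ratios
  \<open>weight_shift\<close> give all five transitions of a cycle the common factor
  \<open>lam * a * W(t)\<close>, leaving only the density \<open>h\<close> at the source of
  each.\<close>

lemma drift_product_form: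
  assumes "0 < mu" "0 < nu" and x: "mu * x = lam * a" and q: "b * q = a"
    and P: "\<And>u. P u = h u * weight (rho_vec mu nu (x, q)) u"
  shows "drift lam mu nu K a b P f = (\<Sum>(j, k, l, m)\<in>Sigma_less K.
      lam * a * weight (rho_vec mu nu (x, q)) (j, k, l, m) *
       (h (j, k, l, m) * (f (Suc j, k, l, m) - f (j, k, l, m))
      + h (Suc j, k, l, m) * (f (j, Suc k, l, m) - f (Suc j, k, l, m))
      + h (j, Suc k, l, m) * (f (j, k, Suc l, m) - f (j, Suc k, l, m))
      + h (j, k, Suc l, m) * (f (j, k, l, Suc m) - f (j, k, Suc l, m))
      + h (j, k, l, Suc m) * (f (j, k, l, m) - f (j, k, l, Suc m))))"
  unfolding drift_cycles
proof (intro sum.cong refl, clarify)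
  fix j k l m
  let ?W = "weight (rho_vec mu nu (x, q))" and ?A = "lam * a * weight (rho_vec mu nu (x, q)) (j, k, l, m)"
  have 1: "nu * (real (Suc j) * P (Suc j, k, l, m)) = ?A * h (Suc j, k, l, m)"
    and 5: "nu * (real (Suc m) * P (j, k, l, Suc m)) = ?A * h (j, k, l, Suc m)"
  proof -
    have "nu * (real (Suc j) * P (Suc j, k, l, m)) = nu * (real (Suc j) * ?W (Suc j, k, l, m)) * h (Suc j, k, l, m)"
      by (simp only: P mult_ac)
    also have "\<dots> = nu * (mu / nu * x * ?W (j, k, l, m)) * h (Suc j, k, l, m)"
      unfolding rho_vec_def fst_conv snd_conv weight_shift ..
    also have "\<dots> = (mu * x) * ?W (j, k, l, m) * h (Suc j, k, l, m)"
      using assms(2) by simp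
    finally show "nu * (real (Suc j) * P (Suc j, k, l, m)) = ?A * h (Suc j, k, l, m)"
      by (simp only: x)
    have "nu * (real (Suc m) * P (j, k, l, Suc m)) = nu * (real (Suc m) * ?W (j, k, l, Suc m)) * h (j, k, l, Suc m)"
      by (simp only: P mult_ac)
    also have "\<dots> = nu * (mu / nu * x * ?W (j, k, l, m)) * h (j, k, l, Suc m)"
      unfolding rho_vec_def fst_conv snd_conv weight_shift ..
    also have "\<dots> = (mu * x) * ?W (j, k, l, m) * h (j, k, l, Suc m)"
      using assms(2) by simp
    finally show "nu * (real (Suc m) * P (j, k, l, Suc m)) = ?A * h (j, k, l, Suc m)"
      by (simp only: x)
  qed
  have "mu * (real (Suc k) * P (j, Suc k, l, m)) = mu * (real (Suc k) * ?W (j, Suc k, l, m)) * h (j, Suc k, l, m)"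
    by (simp only: P mult_ac)
  also have "\<dots> = (mu * x) * ?W (j, k, l, m) * h (j, Suc k, l, m)"
    unfolding rho_vec_def fst_conv snd_conv weight_shift by (simp only: mult_ac)
  finally have 2: "mu * (real (Suc k) * P (j, Suc k, l, m)) = ?A * h (j, Suc k, l, m)"
    by (simp only: x)
  have "lam * b * P (j, k, Suc l, m) = lam * b * ?W (j, k, Suc l, m) * h (j, k, Suc l, m)"
    by (simp only: P mult_ac)
  also have "\<dots> = lam * (b * q) * ?W (j, k, l, m) * h (j, k, Suc l, m)"
    unfolding rho_vec_def fst_conv snd_conv weight_shift by (simp only: mult_ac)
  finally have 3: "lam * b * P (j, k, Suc l, m) = ?A * h (j, k, Suc l, m)"
    by (simp only: q)
  have 0: "lam * a * P (j, k, l, m) = ?A * h (j, k, l, m)"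
    by (simp only: P mult_ac)
  show "lam * a * P (j, k, l, m) * (f (Suc j, k, l, m) - f (j, k, l, m))
    + nu * (real (Suc j) * P (Suc j, k, l, m)) * (f (j, Suc k, l, m) - f (Suc j, k, l, m))
    + mu * (real (Suc k) * P (j, Suc k, l, m)) * (f (j, k, Suc l, m) - f (j, Suc k, l, m))
    + lam * b * P (j, k, Suc l, m) * (f (j, k, l, Suc m) - f (j, k, Suc l, m))
    + nu * (real (Suc m) * P (j, k, l, Suc m)) * (f (j, k, l, m) - f (j, k, l, Suc m))
    = ?A *
       (h (j, k, l, m) * (f (Suc j, k, l, m) - f (j, k, l, m))
      + h (Suc j, k, l, m) * (f (j, Suc k, l, m) - f (Suc j, k, l, m))
      + h (j, Suc k, l, m) * (f (j, k, Suc l, m) - f (j, Suc k, l, m))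
      + h (j, k, Suc l, m) * (f (j, k, l, Suc m) - f (j, k, Suc l, m))
      + h (j, k, l, Suc m) * (f (j, k, l, m) - f (j, k, l, Suc m)))"
    unfolding 0 1 2 3 5 by (simp only: distrib_left mult.assoc)
qed

text \<open>From \<open>a * (b - a) = (b^2 - a^2 - (b - a)^2) / 2\<close>; the differences of
  squares cancel around the cycle.\<close>

lemma cyclic_sum_squares:
  fixes a b c d e :: real
  shows "g * (a * (b - a) + b * (c - b) + c * (d - c) + d * (e - d) + e * (a - e))
    = - (g / 2 * ((b - a)\<^sup>2 + (c - b)\<^sup>2 + (d - c)\<^sup>2 + (e - d)\<^sup>2 + (a - e)\<^sup>2))"
  by (simp add: power2_eq_square field_simps)

lemma five_squares_eq_0:
  fixes a b c d e :: real
  assumes "a\<^sup>2 + b\<^sup>2 + c\<^sup>2 + d\<^sup>2 + e\<^sup>2 = 0"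
  shows "a = 0" "b = 0" "c = 0" "d = 0" "e = 0"
  using assms by (simp_all add: add_nonneg_eq_0_iff)

text \<open>Testing the balance equations with the density \<open>h\<close> itself turns every cycle into minus half
  a sum of squares of increments of \<open>h\<close>.\<close>

lemma balanced_density_const:
  assumes "0 < lam" "0 < mu" "0 < nu" "0 < a" "0 < b"
    and bal: "\<And>f. drift lam mu nu K a b P f = 0"
    and u: "u \<in> Sigma_le K"
  defines "W \<equiv> weight (rho_vec mu nu (lam * a / mu, a / b))"
  shows "P u / W u = P (0, 0, 0, 0) / W (0, 0, 0, 0)"
proof -
  define h where "h = (\<lambda>u. P u / W u)"
  have W: "0 < W u" for u
    unfolding W_def rho_vec_def fst_conv snd_conv using assms by (intro weight_pos) auto
  have P: "P u = h u * W u" for u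
    using W[of u] by (simp add: h_def)
  have x: "mu * (lam * a / mu) = lam * a" and q: "b * (a / b) = a"
    using assms by simp_all
  let ?S = "\<lambda>(j, k, l, m). (h (Suc j, k, l, m) - h (j, k, l, m))\<^sup>2
      + (h (j, Suc k, l, m) - h (Suc j, k, l, m))\<^sup>2 + (h (j, k, Suc l, m) - h (j, Suc k, l, m))\<^sup>2
      + (h (j, k, l, Suc m) - h (j, k, Suc l, m))\<^sup>2 + (h (j, k, l, m) - h (j, k, l, Suc m))\<^sup>2"
  have "(\<Sum>t\<in>Sigma_less K. lam * a * W t / 2 * ?S t) = - drift lam mu nu K a b P h"
    unfolding drift_product_form[OF assms(2,3) x q P[unfolded W_def]] sum_negf[symmetric]
    by (intro sum.cong refl) (clarify, simp only: prod.case cyclic_sum_squares W_def minus_minus)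
  also have "\<dots> = 0" by (simp add: bal)
  finally have "(\<Sum>t\<in>Sigma_less K. lam * a * W t / 2 * ?S t) = 0" .
  moreover have "0 \<le> lam * a * W t / 2 * ?S t" for t
    using assms(1,4) W[of t] by (cases t) (auto intro!: mult_nonneg_nonneg add_nonneg_nonneg)
  ultimately have "lam * a * W t / 2 * ?S t = 0" if "t \<in> Sigma_less K" for t
    using that sum_nonneg_eq_0_iff[OF finite_Sigma_less, where f = "\<lambda>t. lam * a * W t / 2 * ?S t"] by blast
  moreover have "lam * a * W t / 2 \<noteq> 0" for t
    using assms(1,4) W[of t] by simp
  ultimately have S: "?S t = 0" if "t \<in> Sigma_less K" for t
    using that mult_eq_0_iff[of "lam * a * W t / 2" "?S t"] by blast
  have step: "h (Suc j, k, l, m) = h (j, k, l, m) \<and> h (j, Suc k, l, m) = h (j, k, l, m) \<and>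
      h (j, k, Suc l, m) = h (j, k, l, m) \<and> h (j, k, l, Suc m) = h (j, k, l, m)"
    if "(j, k, l, m) \<in> Sigma_less K" for j k l m
    using five_squares_eq_0[OF S[OF that, unfolded prod.case]] by auto
  \<comment> \<open>Each state other than the origin is \<open>t + e_i\<close> with \<open>t\<close>
    in \<open>Sigma_less K\<close>, so constancy along cycles spreads from the origin.\<close>
  have "j + k + l + m \<le> K \<Longrightarrow> h (j, k, l, m) = h (0, 0, 0, 0)" for j k l m
  proof (induction "j + k + l + m" arbitrary: j k l m)
    case (Suc n)
    then consider j' where "j = Suc j'" | k' where "k = Suc k'" | l' where "l = Suc l'" | m' where "m = Suc m'"
      by (metis add_0_right add_is_0 not0_implies_Suc)
    then show ?case
    proof cases
      case 1 then show ?thesis using Suc.hyps(1)[of j' k l m] Suc.hyps(2) Suc.prems step[of j' k l m]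
        by (simp add: Sigma_less_def)
    next
      case 2 then show ?thesis using Suc.hyps(1)[of j k' l m] Suc.hyps(2) Suc.prems step[of j k' l m]
        by (simp add: Sigma_less_def)
    next
      case 3 then show ?thesis using Suc.hyps(1)[of j k l' m] Suc.hyps(2) Suc.prems step[of j k l' m]
        by (simp add: Sigma_less_def)
    next
      case 4 then show ?thesis using Suc.hyps(1)[of j k l m'] Suc.hyps(2) Suc.prems step[of j k l m']
        by (simp add: Sigma_less_def)
    qed
  qed auto
  then have "h u = h (0, 0, 0, 0)"
    using u unfolding Sigma_le_def by blast
  then show ?thesis
    by (simp only: h_def)
qed


subsection \<open>Equilibrium points\<close>

text \<open>Only the inflow and outflow of one coordinate survive. Where a natural subtraction
  truncates, the accompanying coefficient is 0.\<close>

lemma drift_coordinates: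
  shows "drift lam mu nu K a b P (\<lambda>(w, x, y, z). real z)
      = lam * b * (\<Sum>v\<in>Sigma_le K. indicator y_pos v * P v) - nu * (\<Sum>v\<in>Sigma_le K. p4 v * P v)"
    and "drift lam mu nu K a b P (\<lambda>(w, x, y, z). real y)
      = mu * (\<Sum>v\<in>Sigma_le K. p2 v * P v) - lam * b * (\<Sum>v\<in>Sigma_le K. indicator y_pos v * P v)"
    and "drift lam mu nu K a b P (\<lambda>(w, x, y, z). real x)
      = nu * (\<Sum>v\<in>Sigma_le K. p1 v * P v) - mu * (\<Sum>v\<in>Sigma_le K. p2 v * P v)"
proof -
  let ?x = "\<lambda>(w, x, y, z). real x" and ?y = "\<lambda>(w, x, y, z). real y" and ?z = "\<lambda>(w, x, y, z). real z"
  have z: "Delta1_plus ?z v = 0 \<and> Delta12 ?z v = 0 \<and> Delta23 ?z v = 0 \<and> Delta34 ?z v = 1 \<and>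
      Delta4_minus ?z v * p4 v = - p4 v" for v
    by (cases v) (auto simp: of_nat_diff_if algebra_simps)
  have y: "Delta1_plus ?y v = 0 \<and> Delta12 ?y v = 0 \<and> Delta23 ?y v = 1 \<and> Delta4_minus ?y v = 0 \<and>
      Delta34 ?y v * indicator y_pos v = - indicator y_pos v" for v
    by (cases v) (auto simp: y_pos_def of_nat_diff_if indicator_def)
  have x: "Delta1_plus ?x v = 0 \<and> Delta12 ?x v = 1 \<and> Delta34 ?x v = 0 \<and> Delta4_minus ?x v = 0 \<and>
      Delta23 ?x v * p2 v = - p2 v" for v
    by (cases v) (auto simp: of_nat_diff_if algebra_simps)
  show "drift lam mu nu K a b P ?z
      = lam * b * (\<Sum>v\<in>Sigma_le K. indicator y_pos v * P v) - nu * (\<Sum>v\<in>Sigma_le K. p4 v * P v)"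
    by (simp add: drift_def z sum_negf)
  show "drift lam mu nu K a b P ?y
      = mu * (\<Sum>v\<in>Sigma_le K. p2 v * P v) - lam * b * (\<Sum>v\<in>Sigma_le K. indicator y_pos v * P v)"
    by (simp add: drift_def y sum_negf)
  show "drift lam mu nu K a b P ?x
      = nu * (\<Sum>v\<in>Sigma_le K. p1 v * P v) - mu * (\<Sum>v\<in>Sigma_le K. p2 v * P v)"
    by (simp add: drift_def x sum_negf)
qed

lemma prob_eq_sum_indicator:
  "measure_pmf.prob \<Lambda> (Sigma_le K \<inter> A) = (\<Sum>v\<in>Sigma_le K. indicator A v * pmf \<Lambda> v)"
  by (subst measure_measure_pmf_finite)
     (auto simp: finite_Sigma_le sum.inter_restrict indicator_def intro!: sum.cong)

text \<open>If one of the two rates vanishes, the mass balances of the coordinates leave only states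
  \<open>(0, 0, y, 0)\<close>, with \<open>y = 0\<close> or \<open>y = K\<close>.\<close>

lemma equilibrium_rates_pos:
  assumes "0 < lam" "0 < mu" "0 < nu" "0 < s" "s < real K"
    and Y: "\<Lambda> \<in> Y_space K s"
    and a: "a = measure_pmf.prob \<Lambda> (Sigma_le K \<inter> y_pos)" and b: "b = measure_pmf.prob \<Lambda> (Sigma_less K)"
    and bal: "\<And>f. drift lam mu nu K a b (pmf \<Lambda>) f = 0"
  shows "0 < a \<and> 0 < b"
proof (rule ccontr)
  assume neg: "\<not> (0 < a \<and> 0 < b)"
  have "0 \<le> a" "0 \<le> b" by (simp_all add: a b)
  with neg have ab: "a = 0 \<or> b = 0" by auto
  have ind: "(\<Sum>v\<in>Sigma_le K. indicator y_pos v * pmf \<Lambda> v) = a"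
    by (simp add: a prob_eq_sum_indicator)
  have "lam * b * a - nu * (\<Sum>v\<in>Sigma_le K. p4 v * pmf \<Lambda> v) = 0"
    and "mu * (\<Sum>v\<in>Sigma_le K. p2 v * pmf \<Lambda> v) - lam * b * a = 0"
    and "nu * (\<Sum>v\<in>Sigma_le K. p1 v * pmf \<Lambda> v) - mu * (\<Sum>v\<in>Sigma_le K. p2 v * pmf \<Lambda> v) = 0"
    using drift_coordinates[where P = "pmf \<Lambda>" and K = K and lam = lam and mu = mu and nu = nu and a = a and b = b]
    unfolding ind bal by simp_all
  \<comment> \<open>All three balances equate a flow to \<open>lam * b * a\<close>, which is 0
    here.\<close>
  then have "(\<Sum>v\<in>Sigma_le K. p4 v * pmf \<Lambda> v) = 0" "(\<Sum>v\<in>Sigma_le K. p2 v * pmf \<Lambda> v) = 0"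
    "(\<Sum>v\<in>Sigma_le K. p1 v * pmf \<Lambda> v) = 0"
    using ab assms(1-3) by auto
  moreover have "0 \<le> p1 v" and "0 \<le> p2 v" and "0 \<le> p4 v" for v
    by (cases v, simp)+
  ultimately have zero: "p1 v * pmf \<Lambda> v = 0 \<and> p2 v * pmf \<Lambda> v = 0 \<and> p4 v * pmf \<Lambda> v = 0"
    if "v \<in> Sigma_le K" for v
    using that by (simp add: sum_nonneg_eq_0_iff finite_Sigma_le)
  have s: "s = (\<Sum>(w, x, y, z)\<in>Sigma_le K. real (x + y + z) * pmf \<Lambda> (w, x, y, z))"
    and supp: "set_pmf \<Lambda> \<subseteq> Sigma_le K"
    using Y by (auto simp: Y_space_def prob_on_Sigma_def)
  from ab show False
  proof
    assume "a = 0"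
    then have "(\<Sum>v\<in>Sigma_le K \<inter> y_pos. pmf \<Lambda> v) = 0"
      by (simp add: a measure_measure_pmf_finite finite_Sigma_le)
    then have "pmf \<Lambda> v = 0" if "v \<in> Sigma_le K \<inter> y_pos" for v
      using that by (simp add: sum_nonneg_eq_0_iff finite_Sigma_le)
    then have "s = (\<Sum>v\<in>Sigma_le K. 0)"
      unfolding s using zero by (intro sum.cong) (force simp: y_pos_def)+
    with assms(4) show False by simp
  next
    assume "b = 0"
    then have "(\<Sum>v\<in>Sigma_less K. pmf \<Lambda> v) = 0"
      by (simp add: b measure_measure_pmf_finite finite_Sigma_less)
    then have "pmf \<Lambda> v = 0" if "v \<in> Sigma_less K" for v
      using that by (simp add: sum_nonneg_eq_0_iff finite_Sigma_less)
    then have "s = (\<Sum>v\<in>Sigma_le K. real K * pmf \<Lambda> v)"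
      unfolding s using zero by (intro sum.cong) (force simp: Sigma_le_def Sigma_less_def)+
    also have "\<dots> = real K"
      using sum_pmf_eq_1[OF finite_Sigma_le supp] by (simp flip: sum_distrib_left)
    finally show False using assms(5) by simp
  qed
qed

text \<open>The parameters are read off from the rates \<open>a\<close> and \<open>b\<close> of the
  equilibrium. Recomputing \<open>a\<close> from the product form yields the first fixed-point
  equation, and membership in \<open>Y_space\<close> yields the second.\<close>

lemma equilibrium_product_form:
  assumes pos: "0 < lam" "0 < mu" "0 < nu" and K: "1 \<le> K" and s: "0 < s" "s < real K"
    and eq: "equilibrium_point lam mu nu K s \<Lambda>"
  shows "\<exists>r. r \<in> {0..<lam / mu} \<times> {0..} \<and> fixed_point_eqs lam mu nu K s r \<and>
    (\<forall>u\<in>Sigma_le K. pmf \<Lambda> u = product_dist K (rho_vec mu nu r) u)"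
proof -
  define a where "a = measure_pmf.prob \<Lambda> (Sigma_le K \<inter> y_pos)"
  define b where "b = measure_pmf.prob \<Lambda> (Sigma_less K)"
  have Y: "\<Lambda> \<in> Y_space K s" and supp: "set_pmf \<Lambda> \<subseteq> Sigma_le K"
    using eq by (auto simp: equilibrium_point_def Y_space_def prob_on_Sigma_def)
  have bal: "drift lam mu nu K a b (pmf \<Lambda>) f = 0" for f
    using eq Fokker_Planck_const_iff[of \<Lambda> K lam mu nu] unfolding a_def b_def
    by (auto simp: equilibrium_point_def Y_space_def)
  have ab: "0 < a" "0 < b"
    using equilibrium_rates_pos[OF pos s Y a_def b_def bal] by auto
  define x where "x = lam * a / mu"
  define q where "q = a / b"
  let ?W = "weight (rho_vec mu nu (x, q))"
  have xq: "0 < x" "0 < q" using pos ab by (auto simp: x_def q_def)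
  define C where "C = pmf \<Lambda> (0, 0, 0, 0) / ?W (0, 0, 0, 0)"
  have W: "0 < ?W u" for u
    unfolding rho_vec_def fst_conv snd_conv using pos xq by (intro weight_pos) auto
  have C: "pmf \<Lambda> u = C * ?W u" if "u \<in> Sigma_le K" for u
    using balanced_density_const[OF pos ab bal that] W[of u]
    unfolding C_def x_def[symmetric] q_def[symmetric] by (simp add: field_simps)
  have "1 = (\<Sum>u\<in>Sigma_le K. pmf \<Lambda> u)"
    using sum_pmf_eq_1[OF finite_Sigma_le supp] by simp
  also have "\<dots> = C * partition_fun K (rho_vec mu nu (x, q))"
    by (simp add: C partition_fun_def sum_distrib_left)
  finally have "C = 1 / partition_fun K (rho_vec mu nu (x, q))"
    by (cases "partition_fun K (rho_vec mu nu (x, q)) = 0") (auto simp: divide_simps)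
  then have pmf: "pmf \<Lambda> u = product_dist K (rho_vec mu nu (x, q)) u" if "u \<in> Sigma_le K" for u
    using C[OF that] by (simp add: product_dist_def)
  have "a = (\<Sum>u\<in>Sigma_le K \<inter> y_pos. pmf \<Lambda> u)"
    unfolding a_def by (intro measure_measure_pmf_finite finite_Int finite_Sigma_le disjI1)
  also have "\<dots> = busy K (mu / nu) x q"
    unfolding sum_product_dist_y_pos[OF K, symmetric] by (intro sum.cong) (auto simp: pmf)
  finally have busy: "a = busy K (mu / nu) x q" .
  have "s = (\<Sum>(j, k, l, m)\<in>Sigma_le K. real (k + l + m) * pmf \<Lambda> (j, k, l, m))"
    using Y by (simp add: Y_space_def)
  also have "\<dots> = mean K (mu / nu) x q"
    unfolding mean_product_dist[OF pos(2,3) less_imp_le[OF xq(1)] less_imp_le[OF xq(2)] K, symmetric]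
    by (intro sum.cong) (auto simp: pmf)
  finally have "s = mean K (mu / nu) x q" .
  moreover have "x = lam / mu * busy K (mu / nu) x q"
    unfolding busy[symmetric] by (simp add: x_def)
  ultimately have "fixed_point_eqs lam mu nu K s (x, q)"
    using fixed_point_eqs_iff[OF pos(2,3) less_imp_le[OF xq(1)] less_imp_le[OF xq(2)] K] by blast
  moreover have "a < 1"
    unfolding busy using pos xq K by (intro busy_less_1) auto
  then have "x < lam / mu"
    unfolding x_def using pos by (simp add: divide_strict_right_mono)
  ultimately show ?thesis
    using xq pmf by (intro exI[of _ "(x, q)"]) auto
qed

text \<open>A constant density makes the increments of \<open>f\<close> cancel around every cycle,
  once the rates of the constructed measure satisfy the two relations of
  \<open>drift_product_form\<close>.\<close>

lemma ex_equilibrium: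
  assumes pos: "0 < lam" "0 < mu" "0 < nu" and K: "1 \<le> K" and xq: "0 \<le> x" "0 \<le> q"
    and fixed: "fixed_point_eqs lam mu nu K s (x, q)"
  shows "\<exists>\<Lambda>. equilibrium_point lam mu nu K s \<Lambda>"
proof -
  let ?rho = "rho_vec mu nu (x, q)"
  define P where "P = (\<lambda>u. if u \<in> Sigma_le K then product_dist K ?rho u else 0)"
  have part: "0 < partition_fun K ?rho"
    unfolding partition_rho_vec using pos xq by (intro Z_pos) auto
  have W: "0 \<le> weight ?rho u" for u
    unfolding rho_vec_def fst_conv snd_conv using pos xq by (intro weight_nonneg) auto
  have P_nonneg: "0 \<le> P u" for u
    using W[of u] part by (simp add: P_def product_dist_def)
  have "(\<integral>\<^sup>+u. ennreal (P u) \<partial>count_space UNIV) = (\<Sum>u\<in>Sigma_le K. ennreal (P u))"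
    by (rule nn_integral_count_space') (auto simp: finite_Sigma_le P_def)
  also have "\<dots> = ennreal (\<Sum>u\<in>Sigma_le K. P u)"
    by (simp add: P_nonneg)
  also have "(\<Sum>u\<in>Sigma_le K. P u) = 1"
    using sum_product_dist[OF pos(2,3) xq, of K] by (simp add: P_def)
  finally have P_int: "(\<integral>\<^sup>+u. ennreal (P u) \<partial>count_space UNIV) = 1" by simp
  define \<Lambda> where "\<Lambda> = embed_pmf P"
  have pmf: "pmf \<Lambda> u = P u" for u
    unfolding \<Lambda>_def using P_nonneg P_int by (rule pmf_embed_pmf)
  have supp: "\<Lambda> \<in> prob_on_Sigma K"
    by (auto simp: prob_on_Sigma_def set_pmf_iff pmf P_def split: if_splits)
  define a where "a = measure_pmf.prob \<Lambda> (Sigma_le K \<inter> y_pos)"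
  define b where "b = measure_pmf.prob \<Lambda> (Sigma_less K)"
  have "a = (\<Sum>u\<in>Sigma_le K \<inter> y_pos. pmf \<Lambda> u)"
    unfolding a_def by (intro measure_measure_pmf_finite finite_Int finite_Sigma_le disjI1)
  also have "\<dots> = busy K (mu / nu) x q"
    unfolding sum_product_dist_y_pos[OF K, symmetric] by (intro sum.cong) (auto simp: pmf P_def)
  finally have a: "a = busy K (mu / nu) x q" .
  have "b = (\<Sum>u\<in>Sigma_less K. P u)"
    unfolding b_def by (simp add: measure_measure_pmf_finite finite_Sigma_less pmf)
  also have "\<dots> = (\<Sum>u\<in>Sigma_less K. weight ?rho u) / partition_fun K ?rho"
    by (auto simp: P_def product_dist_def sum_divide_distrib dest: subsetD[OF Sigma_less_subset] intro!: sum.cong)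
  also have "(\<Sum>u\<in>Sigma_less K. weight ?rho u) = Z ((1 + 2 * (mu / nu)) * x) q (K - 1)"
    unfolding Sigma_less_eq[OF K] partition_fun_def[symmetric] by (rule partition_rho_vec)
  \<comment> \<open>Here \<open>b\<close> is the ratio of partition functions for
    \<open>K - 1\<close> and \<open>K\<close>, and \<open>a\<close> is \<open>q\<close> times this
    ratio.\<close>
  finally have bq: "b * q = a"
    unfolding a busy_def partition_rho_vec by simp
  have "x = lam / mu * a" and s: "s = mean K (mu / nu) x q"
    using fixed fixed_point_eqs_iff[OF pos(2,3) xq K, of lam s] by (auto simp: a)
  then have x: "mu * x = lam * a" using pos by simp
  \<comment> \<open>The cut-off is needed since \<open>weight\<close> need not vanish outside
    \<open>Sigma_le K\<close>; cycles based in \<open>Sigma_less K\<close> stay inside, so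
    \<open>h\<close> is constant along them.\<close>
  define h where "h = (\<lambda>u. if u \<in> Sigma_le K then 1 / partition_fun K ?rho else 0)"
  have Ph: "pmf \<Lambda> u = h u * weight ?rho u" for u
    by (simp add: pmf P_def h_def product_dist_def)
  have "drift lam mu nu K a b (pmf \<Lambda>) f = 0" for f
    unfolding drift_product_form[OF pos(2,3) x bq Ph]
    by (intro sum.neutral) (auto simp: h_def Sigma_less_def Sigma_le_def diff_divide_distrib)
  then have "Fokker_Planck lam mu nu K (\<lambda>t. \<Lambda>)"
    using Fokker_Planck_const_iff[OF supp] by (simp add: a_def b_def)
  moreover have "(\<Sum>(j, k, l, m)\<in>Sigma_le K. real (k + l + m) * pmf \<Lambda> (j, k, l, m)) = s"
    unfolding s mean_product_dist[OF pos(2,3) xq K, symmetric] by (intro sum.cong) (auto simp: pmf P_def)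
  ultimately show ?thesis
    using supp by (auto simp: equilibrium_point_def Y_space_def)
qed

theorem theorem3:
  fixes lam mu s :: real and K :: nat
  assumes "lam > 0" and "mu > 0" and "K \<ge> 1" and "s > 0" and "s < real K"
  shows "\<exists>nu0>0. \<forall>nu\<ge>nu0.
    (\<exists>!r. r \<in> {0..<lam / mu} \<times> {0..} \<and> fixed_point_eqs lam mu nu K s r) \<and>
    (\<exists>!\<Lambda>. equilibrium_point lam mu nu K s \<Lambda>) \<and>
    (\<forall>r \<Lambda>. r \<in> {0..<lam / mu} \<times> {0..} \<and> fixed_point_eqs lam mu nu K s r \<and>
        equilibrium_point lam mu nu K s \<Lambda> \<longrightarrow>
      (\<forall>u\<in>Sigma_le K. pmf \<Lambda> u = product_dist K (rho_vec mu nu r) u))"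
proof -
  let ?sol = "\<lambda>nu r. r \<in> {0..<lam / mu} \<times> {0..} \<and> fixed_point_eqs lam mu nu K s r"
  obtain nu0 where nu0: "0 < nu0" "\<And>nu. nu0 \<le> nu \<Longrightarrow> \<exists>!r. ?sol nu r"
    using fixed_point_unique[OF assms] by blast
  have main: "(\<exists>!r. ?sol nu r) \<and> (\<exists>!\<Lambda>. equilibrium_point lam mu nu K s \<Lambda>) \<and>
    (\<forall>r \<Lambda>. ?sol nu r \<and> equilibrium_point lam mu nu K s \<Lambda> \<longrightarrow>
      (\<forall>u\<in>Sigma_le K. pmf \<Lambda> u = product_dist K (rho_vec mu nu r) u))"
    if ge: "nu0 \<le> nu" for nu
  proof -
    have nu: "0 < nu" using nu0(1) ge by simp
    obtain r where r: "?sol nu r" and unique: "\<And>r'. ?sol nu r' \<Longrightarrow> r' = r"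
      using nu0(2)[OF ge] by blast
    \<comment> \<open>Each equilibrium yields some solution of the fixed-point equations, which must
      be \<open>r\<close>; hence all equilibria share one formula.\<close>
    have form: "pmf \<Lambda> u = product_dist K (rho_vec mu nu r) u"
      if "equilibrium_point lam mu nu K s \<Lambda>" "u \<in> Sigma_le K" for \<Lambda> u
      using equilibrium_product_form[OF assms(1,2) nu assms(3-5) that(1)] unique that(2) by blast
    obtain \<Lambda> where \<Lambda>: "equilibrium_point lam mu nu K s \<Lambda>"
      using ex_equilibrium[OF assms(1,2) nu assms(3), of "fst r" "snd r" s] r by (cases r) auto
    have "\<Lambda>' = \<Lambda>" if \<Lambda>': "equilibrium_point lam mu nu K s \<Lambda>'" for \<Lambda>'
    proof (rule pmf_eqI)
      fix u
      have "u \<notin> Sigma_le K \<Longrightarrow> pmf \<Lambda>' u = 0 \<and> pmf \<Lambda> u = 0"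
        using \<Lambda> \<Lambda>' by (auto simp: equilibrium_point_def Y_space_def prob_on_Sigma_def pmf_eq_0_set_pmf)
      then show "pmf \<Lambda>' u = pmf \<Lambda> u"
        using form[OF \<Lambda>] form[OF \<Lambda>'] by (cases "u \<in> Sigma_le K") auto
    qed
    with \<Lambda> have "\<exists>!\<Lambda>. equilibrium_point lam mu nu K s \<Lambda>" by blast
    moreover have "\<forall>r \<Lambda>. ?sol nu r \<and> equilibrium_point lam mu nu K s \<Lambda> \<longrightarrow>
      (\<forall>u\<in>Sigma_le K. pmf \<Lambda> u = product_dist K (rho_vec mu nu r) u)"
      using form unique by blast
    ultimately show ?thesis using nu0(2)[OF ge] by blast
  qed
  show ?thesis
    using nu0(1) main by (intro exI[of _ nu0]) blast
qed

end
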